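(* Let $f\in\mathcal H^0$ be given (exact data), let $\gamma\in(0,2\exp(\bar\lambda^2T))$, and let $\mathcal T:\mathcal H^0\to\mathcal H^0$ be the affine operator $\mathcal T\varphi=(I-\gamma\exp(-\Lambda^2T))\varphi+\gamma f$. Let $A=(a_{ij})$ be a segmenting matrix with $\sum_{k=1}^\infty d_k(1-d_k)=\infty$, where $d_k:=a_{k+1,k+1}$. Then $\mathcal T$ has a uniquely determined fixed point $\bar x\in\mathcal H^0$, namely the solution $\bar x=u(0)$ of the backward heat problem with data $f$, and for every $x_1\in\mathcal H^0$ the Mann iteration $M(x_1,A,\mathcal T)$ generates sequences $(x_k)$ and $(v_k)$ which both converge strongly (in the norm of $\mathcal H^0$) to $\bar x$.
   Context: Let $\Omega\subset\mathbb R^n$ be an open bounded set with smooth boundary, $\mathcal H^0:=L^2(\Omega)$ with its usual norm, and let $\Lambda$ be a positive self-adjoint unbounded operator with discrete spectrum, densely defined on $L^2(\Omega)$, with resolution of the identity $E_\lambda$. Put $\bar\lambda:=\inf\sigma(\Lambda)$, a positive constant. Let $T>0$ be a fixed final time. Functions of $\Lambda$ such as $\exp(-\Lambda^2T)$ are defined by the spectral calculus. Let $\mathcal H^1:=\{\varphi\in L^2(\Omega):\|\varphi\|_1^2:=\int_0^\infty(1+\lambda^2)\,d\langle E_\lambda\varphi,\varphi\rangle<\infty\}$ and let $\mathcal H^{-1}$ be its dual. Backward heat problem with data $f\in\mathcal H^0$: $u$ denotes the solution of $(\partial_t+\Lambda^2)u=0$ in $(0,T)\times\Omega$, $u(T)=f$,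 in the space $V=L^2(0,T;\mathcal H^1)$ normed by $\|u\|_V^2=\int_0^T(\|u(t)\|_1^2+\|\partial_tu(t)\|_{-1}^2)\,dt$; the quantity sought is $u(0)$. Segmenting matrix: an infinite real matrix $A=(a_{ij})_{i,j\ge1}$ with (i) $a_{ij}\ge0$ for all $i,j$; (ii) $a_{ij}=0$ for $j>i$; (iii) $\sum_{j=1}^ia_{ij}=1$ for all $i$; (iv) $a_{i+1,j}=(1-a_{i+1,i+1})a_{ij}$ for all $j\le i$. Mann iteration $M(x_1,A,\mathcal T)$: starting from $x_1$, for $k=1,2,\dots$ set $v_k:=\sum_{j=1}^ka_{kj}x_j$ and $x_{k+1}:=\mathcal T(v_k)$. *)

theory Defs
  imports "HOL-Analysis.Analysis"
begin

section \<open>The real Hilbert space of square-integrable functions\<close>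

definition square_integrable :: "('a::euclidean_space \<Rightarrow> real) \<Rightarrow> bool" where
  "square_integrable f \<longleftrightarrow>
     f \<in> borel_measurable lebesgue \<and> integrable lebesgue (\<lambda>x. (f x)\<^sup>2)"

definition L2_rel :: "('a::euclidean_space \<Rightarrow> real) \<Rightarrow> ('a \<Rightarrow> real) \<Rightarrow> bool" where
  "L2_rel f g \<longleftrightarrow>
     square_integrable f \<and> square_integrable g \<and> (AE x in lebesgue. f x = g x)"

lemma square_integrable_zero: "square_integrable (\<lambda>x. 0)"
  by (simp add: square_integrable_def)

lemma square_integrable_scale:
  "square_integrable f \<Longrightarrow> square_integrable (\<lambda>x. c * f x)"
  by (auto simp: square_integrable_def power_mult_distrib)

lemma integrable_mult_square_integrable:
  assumes "square_integrable f" "square_integrable g"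
  shows "integrable lebesgue (\<lambda>x. f x * g x)"
proof (rule Bochner_Integration.integrable_bound)
  show "integrable lebesgue (\<lambda>x. (f x)\<^sup>2 + (g x)\<^sup>2)"
    using assms by (auto simp: square_integrable_def)
  show "(\<lambda>x. f x * g x) \<in> borel_measurable lebesgue"
    using assms by (auto simp: square_integrable_def)
  have "\<bar>a * b\<bar> \<le> a\<^sup>2 + b\<^sup>2" for a b :: real
  proof -
    have "2 * (\<bar>a\<bar> * \<bar>b\<bar>) \<le> a\<^sup>2 + b\<^sup>2"
      using sum_squares_bound[of "\<bar>a\<bar>" "\<bar>b\<bar>"] by simp
    moreover have "0 \<le> \<bar>a\<bar> * \<bar>b\<bar>" by simp
    ultimately show ?thesis unfolding abs_mult by linarith
  qed
  then show "AE x in lebesgue. norm (f x * g x) \<le> norm ((f x)\<^sup>2 + (g x)\<^sup>2)"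
    by simp
qed

lemma square_integrable_add:
  assumes "square_integrable f" "square_integrable g"
  shows "square_integrable (\<lambda>x. f x + g x)"
  using assms integrable_mult_square_integrable[OF assms]
  by (auto simp: square_integrable_def power2_sum mult.assoc)

quotient_type (overloaded) 'a L2 = "'a::euclidean_space \<Rightarrow> real" / partial: L2_rel
proof (rule part_equivpI)
  show "\<exists>x. L2_rel x (x :: 'a \<Rightarrow> real)"
    by (rule exI[of _ "\<lambda>x. 0"]) (simp add: L2_rel_def square_integrable_zero)
  show "symp (L2_rel :: ('a \<Rightarrow> real) \<Rightarrow> _)"
    by (auto simp: symp_def L2_rel_def)
  show "transp (L2_rel :: ('a \<Rightarrow> real) \<Rightarrow> _)"
    unfolding transp_def L2_rel_def by (auto elim: AE_mp)
qed

instantiation L2 :: (euclidean_space) real_vector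
begin

lift_definition zero_L2 :: "'a L2" is "\<lambda>x. 0"
  by (simp add: L2_rel_def square_integrable_zero)

lift_definition plus_L2 :: "'a L2 \<Rightarrow> 'a L2 \<Rightarrow> 'a L2" is "\<lambda>f g x. f x + g x"
  unfolding L2_rel_def by (auto intro: square_integrable_add elim: eventually_elim2)

lift_definition scaleR_L2 :: "real \<Rightarrow> 'a L2 \<Rightarrow> 'a L2" is "\<lambda>c f x. c * f x"
  unfolding L2_rel_def by (auto intro: square_integrable_scale elim: eventually_mono)

lift_definition uminus_L2 :: "'a L2 \<Rightarrow> 'a L2" is "\<lambda>f x. - f x"
  unfolding L2_rel_def by (auto simp: square_integrable_def)

definition minus_L2 :: "'a L2 \<Rightarrow> 'a L2 \<Rightarrow> 'a L2" where "minus_L2 \<phi> \<psi> = \<phi> + - \<psi>"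

instance
proof
  fix a b :: real and x y z :: "'a L2"
  show "x + y + z = x + (y + z)"
    by transfer (auto simp: L2_rel_def add.assoc intro!: square_integrable_add)
  show "x + y = y + x"
    by transfer (auto simp: L2_rel_def add.commute intro!: square_integrable_add)
  show "0 + x = x"
    by transfer (auto simp: L2_rel_def)
  show "- x + x = 0"
    by transfer (auto simp: L2_rel_def square_integrable_def)
  show "x - y = x + - y" by (rule minus_L2_def)
  show "a *\<^sub>R (x + y) = a *\<^sub>R x + a *\<^sub>R y"
    by transfer (auto simp: L2_rel_def distrib_left
        intro!: square_integrable_add square_integrable_scale)
  show "(a + b) *\<^sub>R x = a *\<^sub>R x + b *\<^sub>R x"
    by transfer (auto simp: L2_rel_def distrib_right
        intro!: square_integrable_add square_integrable_scale)
  show "a *\<^sub>R b *\<^sub>R x = (a * b) *\<^sub>R x"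
    by transfer (auto simp: L2_rel_def mult.assoc intro!: square_integrable_scale)
  show "1 *\<^sub>R x = x"
    by transfer (auto simp: L2_rel_def)
qed

end

instantiation L2 :: (euclidean_space) real_inner
begin

lift_definition inner_L2 :: "'a L2 \<Rightarrow> 'a L2 \<Rightarrow> real" is
  "\<lambda>f g. (\<integral>x. f x * g x \<partial>lebesgue)"
  unfolding L2_rel_def
  by (rule integral_cong_AE) (auto simp: square_integrable_def)

definition norm_L2 :: "'a L2 \<Rightarrow> real" where "norm_L2 \<phi> = sqrt (inner \<phi> \<phi>)"

definition sgn_L2 :: "'a L2 \<Rightarrow> 'a L2" where "sgn_L2 \<phi> = \<phi> /\<^sub>R norm \<phi>"

definition dist_L2 :: "'a L2 \<Rightarrow> 'a L2 \<Rightarrow> real" where "dist_L2 \<phi> \<psi> = norm (\<phi> - \<psi>)"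

definition uniformity_L2 :: "('a L2 \<times> 'a L2) filter" where
  "uniformity_L2 = (INF e\<in>{0 <..}. principal {(\<phi>, \<psi>). dist \<phi> \<psi> < e})"

definition open_L2 :: "'a L2 set \<Rightarrow> bool" where
  "open_L2 U \<longleftrightarrow> (\<forall>\<phi>\<in>U. eventually (\<lambda>(\<phi>', \<psi>). \<phi>' = \<phi> \<longrightarrow> \<psi> \<in> U) uniformity)"

instance
proof
  fix a :: real and x y z :: "'a L2"
  show "dist x y = norm (x - y)" by (rule dist_L2_def)
  show "sgn x = x /\<^sub>R norm x" by (rule sgn_L2_def)
  show "uniformity = (INF e\<in>{0 <..}. principal {(x, y :: 'a L2). dist x y < e})"
    by (rule uniformity_L2_def)
  show "inner x y = inner y x"
    by transfer (simp add: mult.commute)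
  show "inner (x + y) z = inner x z + inner y z"
    by transfer
      (simp add: L2_rel_def distrib_right integrable_mult_square_integrable)
  show "inner (a *\<^sub>R x) y = a * inner x y"
    by transfer (simp add: mult.assoc)
  show "0 \<le> inner x x"
    by transfer simp
  show "inner x x = 0 \<longleftrightarrow> x = 0"
  proof transfer
    fix f :: "'a \<Rightarrow> real"
    assume "L2_rel f f"
    then have f: "square_integrable f" by (simp add: L2_rel_def)
    have "(\<integral>x. f x * f x \<partial>lebesgue) = 0 \<longleftrightarrow> (AE x in lebesgue. f x * f x = 0)"
      by (rule integral_nonneg_eq_0_iff_AE)
        (auto intro: integrable_mult_square_integrable f)
    then show "(\<integral>x. f x * f x \<partial>lebesgue) = 0 \<longleftrightarrow> L2_rel f (\<lambda>x. 0)"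
      using f by (simp add: L2_rel_def square_integrable_zero)
  qed
  show "norm x = sqrt (inner x x)" by (rule norm_L2_def)
next
  fix U :: "'a L2 set"
  show "open U \<longleftrightarrow>
      (\<forall>x\<in>U. \<forall>\<^sub>F (x', y) in uniformity. x' = x \<longrightarrow> y \<in> U)"
    by (rule open_L2_def)
qed

end

text \<open>The space \<open>L\<^sup>2(\<Omega>)\<close> is realised, isometrically via extension by zero, as the closed subspace
  of those elements of \<open>L\<^sup>2(\<real>\<^sup>n)\<close> that vanish almost everywhere outside \<open>\<Omega>\<close>.\<close>

lift_definition vanishes_outside :: "'a::euclidean_space set \<Rightarrow> 'a L2 \<Rightarrow> bool" is
  "\<lambda>\<Omega> f. AE x in lebesgue. x \<notin> \<Omega> \<longrightarrow> f x = 0"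
  unfolding L2_rel_def by (auto elim: AE_mp)

definition L2_on :: "'a::euclidean_space set \<Rightarrow> 'a L2 set" where
  "L2_on \<Omega> = {\<phi>. vanishes_outside \<Omega> \<phi>}"


section \<open>Smooth functions and smooth boundaries\<close>

primrec continuously_diff :: "nat \<Rightarrow> ('a::euclidean_space \<Rightarrow> real) \<Rightarrow> bool" where
  "continuously_diff 0 f \<longleftrightarrow> continuous_on UNIV f"
| "continuously_diff (Suc k) f \<longleftrightarrow>
     (\<forall>x. f differentiable (at x)) \<and>
     (\<forall>b\<in>Basis. continuously_diff k (\<lambda>x. frechet_derivative f (at x) b))"

definition smooth :: "('a::euclidean_space \<Rightarrow> real) \<Rightarrow> bool" where
  "smooth f \<longleftrightarrow> (\<forall>k. continuously_diff k f)"

text \<open>Near each boundary point, \<open>\<Omega>\<close> is the part above (\<open>s = 1\<close>) or below (\<open>s = -1\<close>, with \<open>-g\<close> as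
  the bounding function) the graph of a smooth function of all coordinates except the \<open>i\<close>-th.\<close>

definition smooth_boundary :: "(real ^ 'n) set \<Rightarrow> bool" where
  "smooth_boundary \<Omega> \<longleftrightarrow>
     (\<forall>p \<in> frontier \<Omega>. \<exists>r>0. \<exists>i. \<exists>s\<in>{1, -1}. \<exists>g.
        smooth g \<and> (\<forall>x y. (\<forall>j. j \<noteq> i \<longrightarrow> x $ j = y $ j) \<longrightarrow> g x = g y) \<and>
        \<Omega> \<inter> ball p r = {x \<in> ball p r. s * x $ i > g x})"


section \<open>Unbounded self-adjoint operators\<close>

text \<open>Throughout, \<open>H\<close> is a closed subspace of a real inner product type, playing the role of the
  Hilbert space, and an unbounded operator in \<open>H\<close> is given by its domain \<open>D\<close> and a function whose
  values matter on \<open>D\<close> only.\<close>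

definition linear_operator :: "'h::real_inner set \<Rightarrow> 'h set \<Rightarrow> ('h \<Rightarrow> 'h) \<Rightarrow> bool" where
  "linear_operator H D L \<longleftrightarrow>
     subspace D \<and> D \<subseteq> H \<and> L ` D \<subseteq> H \<and>
     (\<forall>\<phi>\<in>D. \<forall>\<psi>\<in>D. L (\<phi> + \<psi>) = L \<phi> + L \<psi>) \<and> (\<forall>c. \<forall>\<phi>\<in>D. L (c *\<^sub>R \<phi>) = c *\<^sub>R L \<phi>)"

definition symmetric_operator :: "'h::real_inner set \<Rightarrow> ('h \<Rightarrow> 'h) \<Rightarrow> bool" where
  "symmetric_operator D L \<longleftrightarrow> (\<forall>\<phi>\<in>D. \<forall>\<psi>\<in>D. inner (L \<phi>) \<psi> = inner \<phi> (L \<psi>))"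

definition adjoint_domain :: "'h::real_inner set \<Rightarrow> 'h set \<Rightarrow> ('h \<Rightarrow> 'h) \<Rightarrow> 'h set" where
  "adjoint_domain H D L = {\<psi> \<in> H. \<exists>\<eta>\<in>H. \<forall>\<phi>\<in>D. inner (L \<phi>) \<psi> = inner \<phi> \<eta>}"

definition self_adjoint :: "'h::real_inner set \<Rightarrow> 'h set \<Rightarrow> ('h \<Rightarrow> 'h) \<Rightarrow> bool" where
  "self_adjoint H D L \<longleftrightarrow>
     linear_operator H D L \<and> H \<subseteq> closure D \<and> symmetric_operator D L \<and> adjoint_domain H D L = D"

definition positive_operator :: "'h::real_inner set \<Rightarrow> ('h \<Rightarrow> 'h) \<Rightarrow> bool" where
  "positive_operator D L \<longleftrightarrow> (\<forall>\<phi>\<in>D. 0 \<le> inner (L \<phi>) \<phi>)"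

definition spectrum :: "'h::real_inner set \<Rightarrow> 'h set \<Rightarrow> ('h \<Rightarrow> 'h) \<Rightarrow> real set" where
  "spectrum H D L =
     {s. \<not> (bij_betw (\<lambda>\<phi>. L \<phi> - s *\<^sub>R \<phi>) D H \<and>
            (\<exists>C. \<forall>\<phi>\<in>D. norm \<phi> \<le> C * norm (L \<phi> - s *\<^sub>R \<phi>)))}"

definition discrete_spectrum :: "'h::real_inner set \<Rightarrow> 'h set \<Rightarrow> ('h \<Rightarrow> 'h) \<Rightarrow> bool" where
  "discrete_spectrum H D L \<longleftrightarrow>
     (\<forall>s \<in> spectrum H D L.
        s isolated_in spectrum H D L \<and>
        (\<exists>\<phi>\<in>D. \<phi> \<noteq> 0 \<and> L \<phi> = s *\<^sub>R \<phi>) \<and>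
        (\<exists>B. finite B \<and> {\<phi> \<in> D. L \<phi> = s *\<^sub>R \<phi>} \<subseteq> span B))"


section \<open>Resolution of the identity and spectral calculus\<close>

definition spectral_family :: "'h::real_inner set \<Rightarrow> (real \<Rightarrow> 'h \<Rightarrow> 'h) \<Rightarrow> bool" where
  "spectral_family H E \<longleftrightarrow>
     (\<forall>s. linear_operator H H (E s) \<and> symmetric_operator H (E s)) \<and>
     (\<forall>s t. \<forall>\<phi>\<in>H. E s (E t \<phi>) = E (min s t) \<phi>) \<and>
     (\<forall>\<phi>\<in>H. \<forall>s. ((\<lambda>t. E t \<phi>) \<longlongrightarrow> E s \<phi>) (at_right s)) \<and>
     (\<forall>\<phi>\<in>H. ((\<lambda>t. E t \<phi>) \<longlongrightarrow> 0) at_bot) \<and>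
     (\<forall>\<phi>\<in>H. ((\<lambda>t. E t \<phi>) \<longlongrightarrow> \<phi>) at_top)"

definition spectral_measure :: "(real \<Rightarrow> 'h \<Rightarrow> 'h) \<Rightarrow> 'h::real_inner \<Rightarrow> real measure" where
  "spectral_measure E \<phi> = interval_measure (\<lambda>s. inner (E s \<phi>) \<phi>)"

text \<open>The integral of \<open>g\<close> with respect to the signed measure \<open>d\<langle>E\<^sub>\<lambda> \<phi>, \<psi>\<rangle>\<close>, by polarisation.\<close>

definition spectral_form ::
    "(real \<Rightarrow> 'h \<Rightarrow> 'h) \<Rightarrow> (real \<Rightarrow> real) \<Rightarrow> 'h::real_inner \<Rightarrow> 'h \<Rightarrow> real" where
  "spectral_form E g \<phi> \<psi> =
     ((\<integral>s. g s \<partial>spectral_measure E (\<phi> + \<psi>)) - (\<integral>s. g s \<partial>spectral_measure E (\<phi> - \<psi>))) / 4"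

definition spectral_domain ::
    "'h::real_inner set \<Rightarrow> (real \<Rightarrow> 'h \<Rightarrow> 'h) \<Rightarrow> (real \<Rightarrow> real) \<Rightarrow> 'h set" where
  "spectral_domain H E g =
     {\<phi> \<in> H. (\<integral>\<^sup>+s. ennreal ((g s)\<^sup>2) \<partial>spectral_measure E \<phi>) < \<infinity>}"

text \<open>\<open>\<eta> = (\<integral>g(\<lambda>) dE\<^sub>\<lambda>) \<phi>\<close> in the weak sense.\<close>

definition spectral_value ::
    "'h::real_inner set \<Rightarrow> (real \<Rightarrow> 'h \<Rightarrow> 'h) \<Rightarrow> (real \<Rightarrow> real) \<Rightarrow> 'h \<Rightarrow> 'h \<Rightarrow> bool" where
  "spectral_value H E g \<phi> \<eta> \<longleftrightarrow>
     \<eta> \<in> H \<and> (\<forall>\<psi>\<in>spectral_domain H E g. inner \<eta> \<psi> = spectral_form E g \<phi> \<psi>)"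

definition spectral_fun ::
    "'h::real_inner set \<Rightarrow> (real \<Rightarrow> 'h \<Rightarrow> 'h) \<Rightarrow> (real \<Rightarrow> real) \<Rightarrow> 'h \<Rightarrow> 'h" where
  "spectral_fun H E g \<phi> = (THE \<eta>. spectral_value H E g \<phi> \<eta>)"

definition resolution_of_identity ::
    "'h::real_inner set \<Rightarrow> 'h set \<Rightarrow> ('h \<Rightarrow> 'h) \<Rightarrow> (real \<Rightarrow> 'h \<Rightarrow> 'h) \<Rightarrow> bool" where
  "resolution_of_identity H D L E \<longleftrightarrow>
     spectral_family H E \<and>
     D = spectral_domain H E (\<lambda>s. s) \<and> (\<forall>\<phi>\<in>D. spectral_value H E (\<lambda>s. s) \<phi> (L \<phi>))"


section \<open>The scale of spaces\<close>

definition H1_energy :: "(real \<Rightarrow> 'h \<Rightarrow> 'h) \<Rightarrow> 'h::real_inner \<Rightarrow> ennreal" where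
  "H1_energy E \<phi> = (\<integral>\<^sup>+s\<in>{0..}. ennreal (1 + s\<^sup>2) \<partial>spectral_measure E \<phi>)"

definition H1 :: "'h::real_inner set \<Rightarrow> (real \<Rightarrow> 'h \<Rightarrow> 'h) \<Rightarrow> 'h set" where
  "H1 H E = {\<phi> \<in> H. H1_energy E \<phi> < \<infinity>}"

definition H1_norm :: "(real \<Rightarrow> 'h \<Rightarrow> 'h) \<Rightarrow> 'h::real_inner \<Rightarrow> real" where
  "H1_norm E \<phi> = sqrt (enn2real (H1_energy E \<phi>))"

definition H1_dual :: "'h::real_inner set \<Rightarrow> (real \<Rightarrow> 'h \<Rightarrow> 'h) \<Rightarrow> ('h \<Rightarrow> real) set" where
  "H1_dual H E =
     {l. (\<forall>\<phi>\<in>H1 H E. \<forall>\<psi>\<in>H1 H E. l (\<phi> + \<psi>) = l \<phi> + l \<psi>) \<and>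
         (\<forall>c. \<forall>\<phi>\<in>H1 H E. l (c *\<^sub>R \<phi>) = c * l \<phi>) \<and>
         (\<exists>C. \<forall>\<phi>\<in>H1 H E. \<bar>l \<phi>\<bar> \<le> C * H1_norm E \<phi>)}"

definition H1_dual_norm :: "'h::real_inner set \<Rightarrow> (real \<Rightarrow> 'h \<Rightarrow> 'h) \<Rightarrow> ('h \<Rightarrow> real) \<Rightarrow> real" where
  "H1_dual_norm H E l = (SUP \<phi>\<in>{\<phi> \<in> H1 H E. H1_norm E \<phi> \<le> 1}. \<bar>l \<phi>\<bar>)"


section \<open>The backward heat problem\<close>

definition test_function :: "real \<Rightarrow> (real \<Rightarrow> real) \<Rightarrow> bool" where
  "test_function T \<theta> \<longleftrightarrow>
     smooth \<theta> \<and> (\<exists>a b. 0 < a \<and> b < T \<and> (\<forall>t. t \<notin> {a..b} \<longrightarrow> \<theta> t = 0))"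

text \<open>\<open>w\<close> is the distributional derivative of \<open>u\<close> on \<open>(0,T)\<close>, as a weakly measurable function with
  values in the dual of \<open>H1\<close>; \<open>H\<close> embeds into that dual through the inner product of \<open>H\<close>.\<close>

definition weak_time_derivative ::
    "'h::real_inner set \<Rightarrow> (real \<Rightarrow> 'h \<Rightarrow> 'h) \<Rightarrow> real \<Rightarrow> (real \<Rightarrow> 'h) \<Rightarrow> (real \<Rightarrow> 'h \<Rightarrow> real) \<Rightarrow> bool" where
  "weak_time_derivative H E T u w \<longleftrightarrow>
     (AE t in lebesgue_on {0<..<T}. w t \<in> H1_dual H E) \<and>
     (\<forall>h\<in>H1 H E. (\<lambda>t. w t h) \<in> borel_measurable (lebesgue_on {0<..<T}) \<and>
        (\<forall>\<theta>. test_function T \<theta> \<longrightarrow>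
           (\<integral>t. inner (u t) h * deriv \<theta> t \<partial>lebesgue_on {0<..<T}) =
           - (\<integral>t. w t h * \<theta> t \<partial>lebesgue_on {0<..<T})))"

text \<open>\<open>u\<close> is in \<open>V\<close> with time derivative \<open>w\<close>. Elements of \<open>V\<close> have a unique representative in
  \<open>C([0,T]; H)\<close>; \<open>u\<close> is required to be that representative, so that \<open>u 0\<close> and \<open>u T\<close> are meaningful.
  Measurability of \<open>u\<close> is then automatic.\<close>

definition in_V ::
    "'h::real_inner set \<Rightarrow> (real \<Rightarrow> 'h \<Rightarrow> 'h) \<Rightarrow> real \<Rightarrow> (real \<Rightarrow> 'h) \<Rightarrow> (real \<Rightarrow> 'h \<Rightarrow> real) \<Rightarrow> bool" where
  "in_V H E T u w \<longleftrightarrow>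
     continuous_on {0..T} u \<and> u ` {0..T} \<subseteq> H \<and>
     (AE t in lebesgue_on {0<..<T}. u t \<in> H1 H E) \<and>
     weak_time_derivative H E T u w \<and>
     (\<integral>\<^sup>+t. ennreal ((H1_norm E (u t))\<^sup>2 + (H1_dual_norm H E (w t))\<^sup>2) \<partial>lebesgue_on {0<..<T}) < \<infinity>"

text \<open>On \<open>H1\<close>, which is the domain of \<open>L\<close>, the operator \<open>L\<^sup>2\<close> takes values in the dual of \<open>H1\<close>:
  it maps \<open>\<phi>\<close> to the functional \<open>h \<mapsto> \<langle>L \<phi>, L h\<rangle>\<close>.\<close>

definition backward_heat_solution ::
    "'h::real_inner set \<Rightarrow> ('h \<Rightarrow> 'h) \<Rightarrow> (real \<Rightarrow> 'h \<Rightarrow> 'h) \<Rightarrow> real \<Rightarrow> 'h \<Rightarrow> (real \<Rightarrow> 'h) \<Rightarrow> bool" where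
  "backward_heat_solution H L E T f u \<longleftrightarrow>
     (\<exists>w. in_V H E T u w \<and>
        (AE t in lebesgue_on {0<..<T}. \<forall>h\<in>H1 H E. w t h + inner (L (u t)) (L h) = 0)) \<and>
     u T = f"


section \<open>Segmenting matrices and the Mann iteration\<close>

text \<open>All indices start at 1; entries with index 0 are irrelevant.\<close>

definition segmenting :: "(nat \<Rightarrow> nat \<Rightarrow> real) \<Rightarrow> bool" where
  "segmenting a \<longleftrightarrow>
     (\<forall>i\<ge>1. \<forall>j\<ge>1. 0 \<le> a i j) \<and>
     (\<forall>i\<ge>1. \<forall>j>i. a i j = 0) \<and>
     (\<forall>i\<ge>1. (\<Sum>j=1..i. a i j) = 1) \<and>
     (\<forall>i\<ge>1. \<forall>j\<in>{1..i}. a (i + 1) j = (1 - a (i + 1) (i + 1)) * a i j)"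

text \<open>The value at \<open>k = 0\<close> is a dummy.\<close>

fun mann_x :: "'h::real_vector \<Rightarrow> (nat \<Rightarrow> nat \<Rightarrow> real) \<Rightarrow> ('h \<Rightarrow> 'h) \<Rightarrow> nat \<Rightarrow> 'h" where
  "mann_x x1 a F k =
     (if k \<le> 1 then x1 else F (\<Sum>j=1..k-1. a (k-1) j *\<^sub>R mann_x x1 a F j))"

declare mann_x.simps [simp del]

definition mann_v :: "'h::real_vector \<Rightarrow> (nat \<Rightarrow> nat \<Rightarrow> real) \<Rightarrow> ('h \<Rightarrow> 'h) \<Rightarrow> nat \<Rightarrow> 'h" where
  "mann_v x1 a F k = (\<Sum>j=1..k. a k j *\<^sub>R mann_x x1 a F j)"

lemma mann_x_1: "mann_x x1 a F 1 = x1"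
  by (simp add: mann_x.simps)

lemma mann_x_Suc: "k \<ge> 1 \<Longrightarrow> mann_x x1 a F (k + 1) = F (mann_v x1 a F k)"
  by (subst mann_x.simps) (simp add: mann_v_def)

end

theory Submission
  imports Defs "HOL-Probability.Distribution_Functions"
begin

text \<open>By the layer-cake formula, \<open>K = exp (-\<Lambda>\<^sup>2T)\<close> is the average over \<open>r \<in> (0,1]\<close> of the spectral
  projections \<open>E\<^sub>s\<close> with \<open>s = sqrt (- ln r / T)\<close>; the Riesz representation theorem makes this an
  operator. It is symmetric, injective, commutes with every \<open>E\<^sub>s\<close>, satisfies
  \<open>\<parallel>K \<phi>\<parallel>\<^sup>2 \<le> exp (-l\<^sup>2T) \<langle>K \<phi>, \<phi>\<rangle>\<close> with \<open>l = inf \<sigma>(\<Lambda>)\<close>, and is bounded below on the range of each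
  \<open>E\<^sub>s\<close>. Since the spectrum is discrete, the eigenvectors are total; testing the heat equation with
  them gives scalar equations, whence \<open>u T = K (u 0)\<close> and \<open>u 0\<close> is the fixed point. For a segmenting
  matrix the errors of the averages obey \<open>e\<^sub>k\<^sub>+\<^sub>1 = e\<^sub>k - \<gamma> d\<^sub>k K e\<^sub>k\<close>. Every step is a contraction, and on
  the range of \<open>E\<^sub>s\<close> the squared norm decays like \<open>exp (-c \<Sum>d\<^sub>k)\<close>, while \<open>e - E\<^sub>s e\<close> remains
  as small as it is initially.\<close>

section \<open>Completeness of \<open>L\<^sup>2\<close>\<close>

text \<open>The spectral calculus is given only weakly: \<open>spectral_fun\<close> is a definite
  description tested against vectors of a domain. Every value must therefore be shown to exist,
  which is why completeness of the function space comes before anything spectral. For the same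
  reason \<open>L\<close> can be reached only through polarised integrals of spectral measures, so
  eigenvectors and gaps of \<open>E\<close> are extracted from norm estimates on small spectral
  windows.

  The obstacle is that no positive lower bound for \<open>K\<close> on all of \<open>H\<close> is
  available: the bound on the range of \<open>E s\<close> is \<open>exp (- s^2 T)\<close>, which
  degenerates as \<open>s\<close> grows. Hence \<open>K x = f\<close> is solved by the given exact
  solution and not by inverting \<open>K\<close>, and the iteration has no uniform rate; the cut-off
  \<open>s\<close> is chosen from the initial error first, and only then the number of steps.

  With \<open>\<kappa> = exp (- l^2 T)\<close>, one relaxation step lowers the squared error by at
  least \<open>\<gamma> (2 - \<gamma> \<kappa>) d\<close> times the quadratic form of
  \<open>K\<close>. For positive \<open>\<gamma>\<close> this factor is positive exactly when
  \<open>\<gamma> < 2 exp (l^2 T)\<close> and \<open>d > 0\<close>, whence the admissible range of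
  \<open>\<gamma>\<close>.\<close>

lemma square_integrable_uminus: "square_integrable f \<Longrightarrow> square_integrable (\<lambda>x. - f x)"
  by (auto simp: square_integrable_def)

lemma square_integrable_diff:
  "square_integrable f \<Longrightarrow> square_integrable g \<Longrightarrow> square_integrable (\<lambda>x. f x - g x)"
  using square_integrable_add[of f "\<lambda>x. - g x"] square_integrable_uminus[of g] by simp

lemma L2_rel_refl: "L2_rel f f \<longleftrightarrow> square_integrable f"
  by (simp add: L2_rel_def)

lemma square_integrable_rep_L2: "square_integrable (rep_L2 \<phi>)"
  using Quotient_rep_reflp[OF Quotient_L2] by (simp add: L2_rel_refl)

lemma abs_L2_rep_L2: "abs_L2 (rep_L2 \<phi>) = \<phi>"
  by (rule Quotient_abs_rep[OF Quotient_L2])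

lemma abs_L2_diff:
  assumes "square_integrable f" "square_integrable g"
  shows "abs_L2 f - abs_L2 g = abs_L2 (\<lambda>x. f x - g x)"
  using assms by (simp add: minus_L2_def uminus_L2.abs_eq plus_L2.abs_eq L2_rel_refl
      square_integrable_uminus)

lemma norm_abs_L2:
  assumes "square_integrable f"
  shows "ennreal ((norm (abs_L2 f))\<^sup>2) = (\<integral>\<^sup>+x. ennreal ((f x)\<^sup>2) \<partial>lebesgue)"
proof -
  have "(norm (abs_L2 f))\<^sup>2 = (\<integral>x. (f x)\<^sup>2 \<partial>lebesgue)"
    using assms unfolding power2_norm_eq_inner
    by (simp add: inner_L2.abs_eq L2_rel_refl power2_eq_square)
  then show ?thesis
    using assms by (simp add: nn_integral_eq_integral square_integrable_def)
qed

lemma norm_diff_rep_L2: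
  "ennreal ((norm (\<phi> - \<psi>))\<^sup>2) = (\<integral>\<^sup>+x. ennreal ((rep_L2 \<phi> x - rep_L2 \<psi> x)\<^sup>2) \<partial>lebesgue)"
  using norm_abs_L2[OF square_integrable_diff[OF square_integrable_rep_L2[of \<phi>] square_integrable_rep_L2[of \<psi>]]]
  by (simp add: abs_L2_diff[symmetric] square_integrable_rep_L2 abs_L2_rep_L2)

text \<open>The growing weight turns boundedness of the weighted terms into geometric decay of
  \<open>g\<close> with ratio \<open>sqrt (1/2)\<close>. It is applied pointwise to the increments
  of a sequence of functions.\<close>

lemma summable_if_weighted_squares_bounded:
  fixes g :: "nat \<Rightarrow> real"
  assumes "(\<Sum>k. ennreal (2 ^ k * (g k)\<^sup>2)) \<noteq> \<infinity>"
  shows "summable g"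
proof -
  have "summable (\<lambda>k. 2 ^ k * (g k)\<^sup>2)"
    by (rule summable_suminf_not_top) (use assms in auto)
  then have "Bseq (\<lambda>k. 2 ^ k * (g k)\<^sup>2)"
    using convergent_imp_Bseq summable_LIMSEQ_zero convergentI by blast
  then obtain C where C: "0 < C" "\<And>k. norm (2 ^ k * (g k)\<^sup>2) \<le> C"
    by (auto elim: BseqE)
  have "norm (g k) \<le> sqrt C * sqrt (1/2) ^ k" for k
  proof -
    have "(g k)\<^sup>2 \<le> C * (1/2) ^ k"
      using C(2)[of k] by (simp add: field_simps)
    then have "sqrt ((g k)\<^sup>2) \<le> sqrt (C * (1/2) ^ k)"
      by (rule real_sqrt_le_mono)
    then show ?thesis
      by (simp only: real_sqrt_mult real_sqrt_power[of "1/2"] real_sqrt_abs real_norm_def)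
  qed
  moreover have "summable (\<lambda>k. sqrt C * sqrt (1/2) ^ k)"
    by (intro summable_mult summable_geometric) simp
  ultimately show ?thesis
    by (rule summable_comparison_test'[rotated])
qed

text \<open>Riesz-Fischer argument: squared distances of order \<open>(1/4)^k\<close> beat the
  weights \<open>2^k\<close>, so the weighted sum of squared increments has finite integral and the
  representatives converge almost everywhere. Fatou's lemma then carries the distance bounds over to
  the pointwise limit.\<close>

lemma fast_Cauchy_L2_convergent:
  fixes X :: "nat \<Rightarrow> 'a::euclidean_space L2"
  assumes fast: "\<And>k m. k \<le> m \<Longrightarrow> norm (X m - X k) \<le> (1/2) ^ k"
  shows "\<exists>L. X \<longlonglongrightarrow> L"
proof -
  define f where "f k = rep_L2 (X k)" for k
  have sq: "square_integrable (f k)" for k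
    by (simp add: f_def square_integrable_rep_L2)
  have meas [measurable]: "f k \<in> borel_measurable lebesgue" for k
    using sq by (simp add: square_integrable_def)
  have diff: "(\<integral>\<^sup>+x. ennreal ((f m x - f k x)\<^sup>2) \<partial>lebesgue) \<le> ennreal ((1/4) ^ k)" if "k \<le> m" for k m
  proof -
    have "(norm (X m - X k))\<^sup>2 \<le> ((1/2) ^ k)\<^sup>2"
      using fast[OF that] by (intro power_mono) auto
    also have "\<dots> = (1/4) ^ k"
      by (simp add: power2_eq_square flip: power_mult_distrib)
    finally show ?thesis
      by (simp add: f_def norm_diff_rep_L2[symmetric])
  qed
  have "(\<integral>\<^sup>+x. (\<Sum>k. ennreal (2 ^ k * (f (Suc k) x - f k x)\<^sup>2)) \<partial>lebesgue) =
      (\<Sum>k. \<integral>\<^sup>+x. ennreal (2 ^ k * (f (Suc k) x - f k x)\<^sup>2) \<partial>lebesgue)"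
    by (rule nn_integral_suminf) measurable
  also have "\<dots> \<le> (\<Sum>k. ennreal ((1/2) ^ k))"
  proof (rule suminf_le)
    fix k
    have "(\<integral>\<^sup>+x. ennreal (2 ^ k * (f (Suc k) x - f k x)\<^sup>2) \<partial>lebesgue) =
        ennreal (2 ^ k) * (\<integral>\<^sup>+x. ennreal ((f (Suc k) x - f k x)\<^sup>2) \<partial>lebesgue)"
      by (simp add: ennreal_mult nn_integral_cmult)
    also have "\<dots> \<le> ennreal (2 ^ k) * ennreal ((1/4) ^ k)"
      by (intro mult_left_mono diff) auto
    also have "\<dots> = ennreal ((1/2) ^ k)"
      by (simp add: ennreal_mult[symmetric] flip: power_mult_distrib)
    finally show "(\<integral>\<^sup>+x. ennreal (2 ^ k * (f (Suc k) x - f k x)\<^sup>2) \<partial>lebesgue) \<le> ennreal ((1/2) ^ k)" .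
  qed auto
  also have "\<dots> < \<infinity>"
    by (simp add: suminf_ennreal2 summable_geometric less_top[symmetric])
  finally have "AE x in lebesgue. (\<Sum>k. ennreal (2 ^ k * (f (Suc k) x - f k x)\<^sup>2)) \<noteq> \<infinity>"
    by (intro nn_integral_PInf_AE) auto
  then have conv: "AE x in lebesgue. convergent (\<lambda>k. f k x)"
  proof eventually_elim
    case (elim x)
    then have "summable (\<lambda>k. f (Suc k) x - f k x)"
      by (rule summable_if_weighted_squares_bounded)
    then have "convergent (\<lambda>n. \<Sum>k<n. f (Suc k) x - f k x)"
      by (simp add: summable_iff_convergent)
    then have "convergent (\<lambda>n. f n x - f 0 x)"
      unfolding sum_lessThan_telescope[of "\<lambda>k. f k x"] .
    then show ?case
      using convergent_diff_const_right_iff by blast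
  qed
  \<comment> \<open>Where the sequence diverges, \<open>lim\<close> takes an arbitrary value; this
    is a null set and \<open>g\<close> stays measurable.\<close>
  define g where "g x = lim (\<lambda>k. f k x)" for x
  have g_meas [measurable]: "g \<in> borel_measurable lebesgue"
    unfolding g_def by measurable
  have lim: "AE x in lebesgue. (\<lambda>k. f k x) \<longlonglongrightarrow> g x"
    using conv by eventually_elim (simp add: g_def convergent_LIMSEQ_iff)
  have bound: "(\<integral>\<^sup>+x. ennreal ((g x - f k x)\<^sup>2) \<partial>lebesgue) \<le> ennreal ((1/4) ^ k)" for k
  proof -
    have "(\<integral>\<^sup>+x. ennreal ((g x - f k x)\<^sup>2) \<partial>lebesgue) =
        (\<integral>\<^sup>+x. liminf (\<lambda>m. ennreal ((f m x - f k x)\<^sup>2)) \<partial>lebesgue)"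
    proof (rule nn_integral_cong_AE, use lim in eventually_elim)
      case (elim x)
      then have "(\<lambda>m. ennreal ((f m x - f k x)\<^sup>2)) \<longlonglongrightarrow> ennreal ((g x - f k x)\<^sup>2)"
        by (intro tendsto_ennrealI tendsto_intros)
      from lim_imp_Liminf[OF _ this] show ?case
        by simp
    qed
    also have "\<dots> \<le> liminf (\<lambda>m. \<integral>\<^sup>+x. ennreal ((f m x - f k x)\<^sup>2) \<partial>lebesgue)"
      by (rule nn_integral_liminf) measurable
    also have "\<dots> \<le> liminf (\<lambda>m. ennreal ((1/4) ^ k))"
      by (rule Liminf_mono) (auto simp: eventually_sequentially intro!: exI[of _ k] diff)
    finally show ?thesis by (simp add: Liminf_const)
  qed
  have sqd: "square_integrable (\<lambda>x. g x - f k x)" for k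
    using bound[of k] by (auto simp: square_integrable_def integrable_iff_bounded intro: le_less_trans)
  then have "square_integrable g"
    using square_integrable_add[OF sqd[of 0] sq[of 0]] by simp
  have "norm (X k - abs_L2 g) \<le> (1/2) ^ k" for k
  proof -
    have "ennreal ((norm (abs_L2 g - abs_L2 (f k)))\<^sup>2) \<le> ennreal ((1/4) ^ k)"
      using \<open>square_integrable g\<close> sq[of k] sqd[of k] bound[of k] by (simp add: abs_L2_diff norm_abs_L2)
    also have "(1/4) ^ k = (((1/2) ^ k)\<^sup>2 :: real)"
      by (simp add: power2_eq_square flip: power_mult_distrib)
    finally have "(norm (abs_L2 g - X k))\<^sup>2 \<le> ((1/2) ^ k)\<^sup>2"
      by (simp add: f_def abs_L2_rep_L2)
    then show ?thesis
      by (simp add: abs_le_square_iff[symmetric] norm_minus_commute)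
  qed
  moreover have "(\<lambda>k. (1/2) ^ k :: real) \<longlonglongrightarrow> 0"
    by (intro LIMSEQ_power_zero) simp
  ultimately have "(\<lambda>k. X k - abs_L2 g) \<longlonglongrightarrow> 0"
    by (intro Lim_null_comparison[of "\<lambda>k. X k - abs_L2 g"]) auto
  then show ?thesis
    using LIM_zero_cancel by blast
qed

lemma complete_UNIV_L2: "complete (UNIV :: 'a::euclidean_space L2 set)"
proof (rule completeI)
  fix X :: "nat \<Rightarrow> 'a L2"
  assume X: "Cauchy X"
  have "\<forall>k. \<exists>N. \<forall>m\<ge>N. \<forall>n\<ge>N. norm (X m - X n) < (1/2) ^ k"
    using X by (auto simp: Cauchy_def dist_norm)
  then obtain N where N: "\<And>k m n. m \<ge> N k \<Longrightarrow> n \<ge> N k \<Longrightarrow> norm (X m - X n) < (1/2) ^ k"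
    by metis
  \<comment> \<open>Adding all earlier thresholds puts \<open>r k\<close> above \<open>N k\<close>,
    and the summand \<open>k\<close> makes \<open>r\<close> strictly increasing.\<close>
  define r where "r k = k + (\<Sum>j\<le>k. N j)" for k
  have r: "strict_mono r"
    by (rule strict_monoI_Suc) (simp add: r_def)
  have rN: "N k \<le> r k" for k
    unfolding r_def using member_le_sum[of k "{..k}" N] by auto
  have "norm (X (r m) - X (r k)) \<le> (1/2) ^ k" if "k \<le> m" for k m
    using N[of k "r m" "r k"] rN[of k] strict_mono_leD[OF r that] by (simp add: order.strict_implies_order)
  then obtain L where "(\<lambda>k. X (r k)) \<longlonglongrightarrow> L"
    using fast_Cauchy_L2_convergent[of "X \<circ> r"] by (auto simp: o_def)
  then show "\<exists>L\<in>UNIV. X \<longlonglongrightarrow> L"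
    using Cauchy_converges_subseq[OF X r] by (auto simp: o_def)
qed

section \<open>The closed subspace of functions vanishing outside a set\<close>

lemma subspace_L2_on: "subspace (L2_on \<Omega>)"
proof -
  have "0 \<in> L2_on \<Omega>"
    unfolding L2_on_def mem_Collect_eq by transfer simp
  moreover have "\<phi> + \<psi> \<in> L2_on \<Omega>" if "\<phi> \<in> L2_on \<Omega>" "\<psi> \<in> L2_on \<Omega>" for \<phi> \<psi>
    using that unfolding L2_on_def mem_Collect_eq by transfer (auto elim: eventually_elim2)
  moreover have "c *\<^sub>R \<phi> \<in> L2_on \<Omega>" if "\<phi> \<in> L2_on \<Omega>" for c \<phi>
    using that unfolding L2_on_def mem_Collect_eq by transfer (auto elim: eventually_mono)
  ultimately show ?thesis
    by (auto simp: subspace_def)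
qed

lemma complete_L2_on:
  assumes "\<Omega> \<in> sets lebesgue"
  shows "complete (L2_on \<Omega>)"
proof (rule completeI)
  fix X :: "nat \<Rightarrow> 'a L2"
  assume X: "\<forall>n. X n \<in> L2_on \<Omega>" "Cauchy X"
  then obtain L where L: "X \<longlonglongrightarrow> L"
    using complete_UNIV_L2 unfolding complete_def by blast
  have meas [measurable]: "rep_L2 \<phi> \<in> borel_measurable lebesgue" for \<phi> :: "'a L2"
    using square_integrable_rep_L2[of \<phi>] by (simp add: square_integrable_def)
  have [measurable]: "- \<Omega> \<in> sets lebesgue"
    using sets.compl_sets[OF assms] by (simp add: Compl_eq_Diff_UNIV)
  have van: "vanishes_outside \<Omega> \<phi> \<longleftrightarrow> (AE x in lebesgue. x \<notin> \<Omega> \<longrightarrow> rep_L2 \<phi> x = 0)" for \<phi> :: "'a L2"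
    using vanishes_outside.abs_eq[of "rep_L2 \<phi>" \<Omega>]
    by (simp add: L2_rel_refl square_integrable_rep_L2 abs_L2_rep_L2)
  \<comment> \<open>\<open>J\<close> is the squared mass of the limit outside the set; each
    \<open>X n\<close> has none there, so \<open>J\<close> is at most the squared distance to
    \<open>X n\<close>.\<close>
  define J where "J = (\<integral>\<^sup>+x. ennreal ((rep_L2 L x)\<^sup>2) * indicator (- \<Omega>) x \<partial>lebesgue)"
  have "J \<le> ennreal ((norm (L - X n))\<^sup>2)" for n
  proof -
    have "AE x in lebesgue. x \<notin> \<Omega> \<longrightarrow> rep_L2 (X n) x = 0"
      using X(1) by (simp add: L2_on_def van)
    then have "J \<le> (\<integral>\<^sup>+x. ennreal ((rep_L2 L x - rep_L2 (X n) x)\<^sup>2) \<partial>lebesgue)"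
      unfolding J_def by (intro nn_integral_mono_AE) (auto elim!: eventually_mono simp: indicator_def)
    then show ?thesis
      by (simp add: norm_diff_rep_L2)
  qed
  moreover have "(\<lambda>n. ennreal ((norm (L - X n))\<^sup>2)) \<longlonglongrightarrow> ennreal ((norm (L - L))\<^sup>2)"
    by (intro tendsto_ennrealI tendsto_intros L)
  ultimately have "J \<le> 0"
    by (intro LIMSEQ_le_const[of "\<lambda>n. ennreal ((norm (L - X n))\<^sup>2)"]) auto
  then have "AE x in lebesgue. ennreal ((rep_L2 L x)\<^sup>2) * indicator (- \<Omega>) x = 0"
    unfolding J_def by (subst (asm) le_zero_eq, subst (asm) nn_integral_0_iff_AE) auto
  then have "L \<in> L2_on \<Omega>"
    by (auto simp: L2_on_def van indicator_def elim!: eventually_mono)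
  with L show "\<exists>L\<in>L2_on \<Omega>. X \<longlonglongrightarrow> L" by blast
qed

section \<open>The Riesz representation theorem\<close>

text \<open>First-order optimality: for small \<open>t\<close> of sign opposite to \<open>b\<close>
  the linear term dominates and the expression would be negative.\<close>

lemma quadratic_nonneg_imp_linear_zero:
  fixes b c :: real
  assumes "\<And>t. 0 \<le> 2 * t * b + t\<^sup>2 * c"
  shows "b = 0"
proof (rule ccontr)
  assume "b \<noteq> 0"
  define t where "t = - b / (\<bar>c\<bar> + 1)"
  have t: "b = - t * (\<bar>c\<bar> + 1)"
    by (simp add: t_def)
  have "t \<noteq> 0"
    using \<open>b \<noteq> 0\<close> by (simp add: t_def)
  have "0 \<le> t\<^sup>2 * (c - 2 * (\<bar>c\<bar> + 1))"
    using assms[of t] by (simp add: t power2_eq_square algebra_simps)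
  then have "0 \<le> c - 2 * (\<bar>c\<bar> + 1)"
    using \<open>t \<noteq> 0\<close> by (simp add: zero_le_mult_iff)
  then show False
    by (cases "0 \<le> c") auto
qed

text \<open>The representing vector is the limit of a minimising sequence of \<open>\<parallel>\<psi>\<parallel>\<^sup>2 - 2 l \<psi>\<close>, which is
  Cauchy by the parallelogram law.\<close>

lemma Riesz_representation:
  fixes S :: "'h::real_inner set" and l :: "'h \<Rightarrow> real"
  assumes S: "subspace S" "complete S"
    and add: "\<And>\<phi> \<psi>. \<phi> \<in> S \<Longrightarrow> \<psi> \<in> S \<Longrightarrow> l (\<phi> + \<psi>) = l \<phi> + l \<psi>"
    and scale: "\<And>c \<phi>. \<phi> \<in> S \<Longrightarrow> l (c *\<^sub>R \<phi>) = c * l \<phi>"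
    and bound: "\<And>\<phi>. \<phi> \<in> S \<Longrightarrow> \<bar>l \<phi>\<bar> \<le> C * norm \<phi>"
  shows "\<exists>\<eta>\<in>S. \<forall>\<psi>\<in>S. inner \<eta> \<psi> = l \<psi>"
proof -
  define J where "J \<phi> = (norm \<phi>)\<^sup>2 - 2 * l \<phi>" for \<phi>
  define m where "m = (INF \<phi>\<in>S. J \<phi>)"
  have J_lower: "- C\<^sup>2 \<le> J \<phi>" if "\<phi> \<in> S" for \<phi>
  proof -
    have "0 \<le> (norm \<phi> - C)\<^sup>2" by simp
    then have "2 * (C * norm \<phi>) \<le> (norm \<phi>)\<^sup>2 + C\<^sup>2"
      by (simp add: power2_diff algebra_simps)
    then show ?thesis
      using bound[OF that] unfolding J_def by linarith
  qed
  have m_le: "m \<le> J \<phi>" if "\<phi> \<in> S" for \<phi>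
    unfolding m_def using that J_lower by (intro cINF_lower bdd_belowI2[of _ "- C\<^sup>2"]) auto
  have "\<exists>\<phi>\<in>S. J \<phi> < m + 1 / real (Suc n)" for n
  proof -
    have "S \<noteq> {}" using subspace_0[OF S(1)] by blast
    moreover have "bdd_below (J ` S)"
      using J_lower by (intro bdd_belowI2[of _ "- C\<^sup>2"]) auto
    ultimately show ?thesis
      using cINF_less_iff[of S J "m + 1 / real (Suc n)"] unfolding m_def by auto
  qed
  then obtain X where X: "\<And>n. X n \<in> S" "\<And>n. J (X n) < m + 1 / real (Suc n)"
    by metis
  \<comment> \<open>Parallelogram law at the midpoint \<open>M\<close>: it lies in \<open>S\<close>,
    so \<open>J M\<close> cannot fall below the infimum, while \<open>J (X n)\<close> and
    \<open>J (X k)\<close> are close to it.\<close>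
  have dist_X: "(norm (X n - X k))\<^sup>2 \<le> 2 / real (Suc n) + 2 / real (Suc k)" for n k
  proof -
    define M where "M = (1/2) *\<^sub>R (X n + X k)"
    have sum_S: "X n + X k \<in> S"
      using X(1) S(1) by (simp add: subspace_add)
    have "M \<in> S"
      unfolding M_def by (rule subspace_scale[OF S(1) sum_S])
    have lM: "l M = (l (X n) + l (X k)) / 2"
      unfolding M_def scale[OF sum_S] add[OF X(1) X(1)] by simp
    have "(norm (X n - X k))\<^sup>2 = 2 * J (X n) + 2 * J (X k) - 4 * J M"
      unfolding J_def lM unfolding M_def power2_norm_eq_inner
      by (simp add: inner_commute algebra_simps)
    moreover have "2 / real (Suc i) = 2 * (1 / real (Suc i))" for i by simp
    ultimately show ?thesis
      using X(2)[of n] X(2)[of k] m_le[OF \<open>M \<in> S\<close>] by linarith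
  qed
  have "Cauchy X"
  proof (rule CauchyI)
    fix e :: real assume "0 < e"
    then obtain N where N: "4 / e\<^sup>2 < real (Suc N)"
      using reals_Archimedean2 less_Suc_eq of_nat_less_iff by (metis less_trans lessI)
    have "norm (X n - X k) < e" if "N \<le> n" "N \<le> k" for n k
    proof -
      have "2 / real (Suc n) \<le> 2 / real (Suc N)" "2 / real (Suc k) \<le> 2 / real (Suc N)"
        using that by (auto intro!: divide_left_mono)
      then have "(norm (X n - X k))\<^sup>2 \<le> 4 / real (Suc N)"
        using dist_X[of n k] by simp
      also have "\<dots> < e\<^sup>2"
        using N \<open>0 < e\<close> by (simp add: field_simps)
      finally show ?thesis
        using \<open>0 < e\<close> by (simp add: power2_less_imp_less)
    qed
    then show "\<exists>M. \<forall>m\<ge>M. \<forall>n\<ge>M. norm (X m - X n) < e" by blast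
  qed
  then obtain \<eta> where \<eta>: "\<eta> \<in> S" "X \<longlonglongrightarrow> \<eta>"
    using S(2) X(1) unfolding complete_def by blast
  have "inner \<eta> \<psi> = l \<psi>" if \<psi>: "\<psi> \<in> S" for \<psi>
  proof -
    \<comment> \<open>Perturbing \<open>X n\<close> in direction \<open>\<psi>\<close> cannot bring
      \<open>J\<close> below the infimum; the slack \<open>1 / Suc n\<close> disappears in the limit
      and leaves the optimality condition.\<close>
    have "0 \<le> 2 * t * (inner \<eta> \<psi> - l \<psi>) + t\<^sup>2 * (norm \<psi>)\<^sup>2" for t
    proof (rule LIMSEQ_le)
      show "(\<lambda>n. - (1 / real (Suc n))) \<longlonglongrightarrow> 0"
        using tendsto_minus[OF LIMSEQ_Suc[OF lim_1_over_n]] by simp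
      show "(\<lambda>n. 2 * t * (inner (X n) \<psi> - l \<psi>) + t\<^sup>2 * (norm \<psi>)\<^sup>2)
          \<longlonglongrightarrow> 2 * t * (inner \<eta> \<psi> - l \<psi>) + t\<^sup>2 * (norm \<psi>)\<^sup>2"
        by (intro tendsto_intros \<eta>)
      have "- (1 / real (Suc n)) \<le> 2 * t * (inner (X n) \<psi> - l \<psi>) + t\<^sup>2 * (norm \<psi>)\<^sup>2" for n
      proof -
        have t\<psi>: "t *\<^sub>R \<psi> \<in> S"
          using S(1) \<psi> by (simp add: subspace_scale)
        have "m \<le> J (X n + t *\<^sub>R \<psi>)"
          using S(1) X(1) t\<psi> by (intro m_le) (simp add: subspace_add)
        also have "\<dots> = J (X n) + (2 * t * (inner (X n) \<psi> - l \<psi>) + t\<^sup>2 * (norm \<psi>)\<^sup>2)"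
          unfolding J_def add[OF X(1) t\<psi>] scale[OF \<psi>] power2_norm_eq_inner
          by (simp add: inner_commute algebra_simps power2_eq_square)
        finally show ?thesis
          using X(2)[of n] by linarith
      qed
      then show "\<exists>N. \<forall>n\<ge>N. - (1 / real (Suc n)) \<le> 2 * t * (inner (X n) \<psi> - l \<psi>) + t\<^sup>2 * (norm \<psi>)\<^sup>2"
        by blast
    qed
    then show ?thesis
      using quadratic_nonneg_imp_linear_zero by fastforce
  qed
  with \<eta>(1) show ?thesis by blast
qed

section \<open>Spectral families\<close>

locale spectral_space =
  fixes H :: "'h::real_inner set" and E :: "real \<Rightarrow> 'h \<Rightarrow> 'h"
  assumes subspace_H: "subspace H" and family: "spectral_family H E"
begin

lemma E_in [simp]: "\<phi> \<in> H \<Longrightarrow> E s \<phi> \<in> H"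
  using family unfolding spectral_family_def linear_operator_def by blast

lemma E_add: "\<phi> \<in> H \<Longrightarrow> \<psi> \<in> H \<Longrightarrow> E s (\<phi> + \<psi>) = E s \<phi> + E s \<psi>"
  using family by (auto simp: spectral_family_def linear_operator_def)

lemma E_scale: "\<phi> \<in> H \<Longrightarrow> E s (c *\<^sub>R \<phi>) = c *\<^sub>R E s \<phi>"
  using family by (auto simp: spectral_family_def linear_operator_def)

lemma E_sym: "\<phi> \<in> H \<Longrightarrow> \<psi> \<in> H \<Longrightarrow> inner (E s \<phi>) \<psi> = inner \<phi> (E s \<psi>)"
  using family by (auto simp: spectral_family_def symmetric_operator_def)

lemma E_E: "\<phi> \<in> H \<Longrightarrow> E s (E t \<phi>) = E (min s t) \<phi>"
  using family by (auto simp: spectral_family_def)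

lemma E_right_cont: "\<phi> \<in> H \<Longrightarrow> ((\<lambda>t. E t \<phi>) \<longlongrightarrow> E s \<phi>) (at_right s)"
  using family by (auto simp: spectral_family_def)

lemma E_at_bot: "\<phi> \<in> H \<Longrightarrow> ((\<lambda>t. E t \<phi>) \<longlongrightarrow> 0) at_bot"
  using family by (auto simp: spectral_family_def)

lemma E_at_top: "\<phi> \<in> H \<Longrightarrow> ((\<lambda>t. E t \<phi>) \<longlongrightarrow> \<phi>) at_top"
  using family by (auto simp: spectral_family_def)

lemma H_diff [simp]: "\<phi> \<in> H \<Longrightarrow> \<psi> \<in> H \<Longrightarrow> \<phi> - \<psi> \<in> H"
  by (rule subspace_diff[OF subspace_H])

lemma H_add [simp]: "\<phi> \<in> H \<Longrightarrow> \<psi> \<in> H \<Longrightarrow> \<phi> + \<psi> \<in> H"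
  by (rule subspace_add[OF subspace_H])

lemma H_scale [simp]: "\<phi> \<in> H \<Longrightarrow> c *\<^sub>R \<phi> \<in> H"
  by (rule subspace_scale[OF subspace_H])

lemma E_diff: "\<phi> \<in> H \<Longrightarrow> \<psi> \<in> H \<Longrightarrow> E s (\<phi> - \<psi>) = E s \<phi> - E s \<psi>"
  using E_add[of \<phi> "(-1) *\<^sub>R \<psi>" s] E_scale[of \<psi> s "-1"] H_scale[of \<psi> "-1"] by simp

lemma inner_E_self: "\<phi> \<in> H \<Longrightarrow> inner (E s \<phi>) \<phi> = (norm (E s \<phi>))\<^sup>2"
  using E_sym[of "E s \<phi>" \<phi> s] E_E[of \<phi> s s] by (simp add: power2_norm_eq_inner)

lemma norm_E_le:
  assumes "\<phi> \<in> H"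
  shows "norm (E s \<phi>) \<le> norm \<phi>"
proof -
  have "norm (E s \<phi>) * norm (E s \<phi>) \<le> norm (E s \<phi>) * norm \<phi>"
    using norm_cauchy_schwarz[of "E s \<phi>" \<phi>] inner_E_self[OF assms, of s] by (simp add: power2_eq_square)
  then show ?thesis
    by (metis mult_le_cancel_left_pos norm_ge_zero order_le_less)
qed

lemma inner_E_mono:
  assumes "\<phi> \<in> H" "s \<le> t"
  shows "inner (E s \<phi>) \<phi> \<le> inner (E t \<phi>) \<phi>"
proof -
  have "norm (E s \<phi>) \<le> norm (E t \<phi>)"
    using norm_E_le[of "E t \<phi>" s] E_E[of \<phi> s t] assms by (simp add: min_absorb1)
  then show ?thesis
    using assms by (simp add: inner_E_self power_mono)
qed

lemma inner_E_polar:
  assumes "\<phi> \<in> H" "\<psi> \<in> H"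
  shows "inner (E s \<phi>) \<psi> =
    (inner (E s (\<phi> + \<psi>)) (\<phi> + \<psi>) - inner (E s (\<phi> - \<psi>)) (\<phi> - \<psi>)) / 4"
  using assms E_sym[of \<phi> \<psi> s] by (simp add: E_add E_diff inner_commute algebra_simps)

text \<open>The diagonal functions are monotone, hence Borel; polarisation expresses every matrix
  element by two of them.\<close>

lemma borel_measurable_inner_E [measurable]:
  assumes "\<phi> \<in> H" "\<psi> \<in> H"
  shows "(\<lambda>s. inner (E s \<phi>) \<psi>) \<in> borel_measurable borel"
proof -
  have quad: "(\<lambda>s. inner (E s \<phi>) \<phi>) \<in> borel_measurable borel" if "\<phi> \<in> H" for \<phi>
    using inner_E_mono[OF that] by (intro borel_measurable_mono) (auto simp: mono_def)
  note [measurable] = quad[OF H_add[OF assms]] quad[OF H_diff[OF assms]]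
  show ?thesis
    unfolding inner_E_polar[OF assms] by measurable
qed

text \<open>The function \<open>inner (E s \<phi>) \<phi>\<close> is increasing and right-continuous
  with limits 0 and the squared norm of \<open>\<phi>\<close>, so it is the distribution function of
  a finite measure.\<close>

lemma
  assumes "\<phi> \<in> H"
  shows emeasure_spectral_measure_Iic: "emeasure (spectral_measure E \<phi>) {..x} = inner (E x \<phi>) \<phi>"
    and emeasure_spectral_measure_UNIV: "emeasure (spectral_measure E \<phi>) UNIV = (norm \<phi>)\<^sup>2"
    and finite_borel_measure_spectral_measure: "finite_borel_measure (spectral_measure E \<phi>)"
proof -
  have rc: "continuous (at_right a) (\<lambda>s. inner (E s \<phi>) \<phi>)" for a
    unfolding continuous_within by (intro tendsto_intros E_right_cont assms)
  have bot: "((\<lambda>s. inner (E s \<phi>) \<phi>) \<longlongrightarrow> 0) at_bot"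
    using tendsto_inner[OF E_at_bot[OF assms] tendsto_const[of \<phi>]] by simp
  have top: "((\<lambda>s. inner (E s \<phi>) \<phi>) \<longlongrightarrow> (norm \<phi>)\<^sup>2) at_top"
    using tendsto_inner[OF E_at_top[OF assms] tendsto_const[of \<phi>]] by (simp add: power2_norm_eq_inner)
  note mono = inner_E_mono[OF assms]
  show "emeasure (spectral_measure E \<phi>) {..x} = inner (E x \<phi>) \<phi>"
    unfolding spectral_measure_def by (rule emeasure_interval_measure_Iic[OF mono rc bot])
  show "emeasure (spectral_measure E \<phi>) UNIV = (norm \<phi>)\<^sup>2"
    unfolding spectral_measure_def by (rule interval_measure_UNIV[OF mono rc bot top]) simp_all
  show "finite_borel_measure (spectral_measure E \<phi>)"
    unfolding spectral_measure_def
    by (rule finite_borel_measure_interval_measure[OF mono rc bot top]) simp_all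
qed

lemma sets_spectral_measure [measurable_cong, simp]: "sets (spectral_measure E \<phi>) = sets borel"
  by (simp add: spectral_measure_def)

lemma space_spectral_measure [simp]: "space (spectral_measure E \<phi>) = UNIV"
  by (simp add: spectral_measure_def)

lemma finite_measure_spectral_measure: "\<phi> \<in> H \<Longrightarrow> finite_measure (spectral_measure E \<phi>)"
  using finite_borel_measure_spectral_measure by (simp add: finite_borel_measure_def)

lemma measure_spectral_measure_UNIV: "\<phi> \<in> H \<Longrightarrow> measure (spectral_measure E \<phi>) UNIV = (norm \<phi>)\<^sup>2"
  by (simp add: measure_def emeasure_spectral_measure_UNIV)

end

section \<open>The heat operator\<close>

definition unit_measure :: "real measure" where
  "unit_measure = restrict_space lborel {0<..1}"

lemma space_unit_measure [simp]: "space unit_measure = {0<..1}"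
  by (simp add: unit_measure_def space_restrict_space)

lemma borel_measurable_unit_measure: "f \<in> borel_measurable borel \<Longrightarrow> f \<in> borel_measurable unit_measure"
  unfolding unit_measure_def by (rule measurable_restrict_space1) simp

lemma emeasure_unit_measure_atMost:
  assumes "0 \<le> c" "c \<le> 1"
  shows "emeasure unit_measure {0<..c} = c"
  using assms unfolding unit_measure_def by (subst emeasure_restrict_space) auto

lemma finite_measure_unit_measure: "finite_measure unit_measure"
  by standard (simp add: emeasure_unit_measure_atMost)

lemma measure_unit_measure_UNIV: "measure unit_measure (space unit_measure) = 1"
  by (simp add: measure_def emeasure_unit_measure_atMost)

lemma sets_unit_measure_atMost: "c \<le> 1 \<Longrightarrow> {0<..c} \<in> sets unit_measure"
  by (auto simp: unit_measure_def sets_restrict_space_iff)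

lemma
  assumes "0 \<le> c" "c \<le> 1"
  shows integral_unit_measure_step: "(\<integral>r. (if r \<le> c then y else 0) \<partial>unit_measure) = c * (y::real)"
    and integrable_unit_measure_step: "integrable unit_measure (\<lambda>r. if r \<le> c then y else 0)"
proof -
  have cong: "(if r \<le> c then y else 0) = y * indicator {0<..c} r" if "r \<in> space unit_measure" for r
    using that by (auto simp: indicator_def)
  have "integrable unit_measure (\<lambda>r. y * indicator {0<..c} r)"
    using assms emeasure_unit_measure_atMost sets_unit_measure_atMost
    by (intro integrable_mult_right integrable_real_indicator) auto
  moreover have "integrable unit_measure (\<lambda>r. if r \<le> c then y else 0) \<longleftrightarrow>
      integrable unit_measure (\<lambda>r. y * indicator {0<..c} r)"
    by (rule Bochner_Integration.integrable_cong[OF refl cong])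
  ultimately show "integrable unit_measure (\<lambda>r. if r \<le> c then y else 0)"
    by blast
  have "(\<integral>r. (if r \<le> c then y else 0) \<partial>unit_measure) = (\<integral>r. y * indicator {0<..c} r \<partial>unit_measure)"
    by (rule Bochner_Integration.integral_cong[OF refl cong])
  also have "\<dots> = c * y"
  proof -
    have "{0<..c} \<inter> {0<..1} = {0<..c}" using assms by auto
    then show ?thesis
      using assms by (simp add: measure_def emeasure_unit_measure_atMost)
  qed
  finally show "(\<integral>r. (if r \<le> c then y else 0) \<partial>unit_measure) = c * y" .
qed

text \<open>The assumption \<open>gap\<close> states through \<open>E\<close> alone that there is no
  spectrum below \<open>l\<close>. The analysis of the heat operator and of the iteration thus needs
  no unbounded operator.\<close>

locale coercive_spectral_space = spectral_space +
  fixes l T :: real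
  assumes complete_H: "complete H"
    and l_pos: "0 < l" and T_pos: "0 < T"
    and gap: "\<And>s \<phi>. s < l \<Longrightarrow> \<phi> \<in> H \<Longrightarrow> E s \<phi> = 0"
begin

definition heat_symbol :: "real \<Rightarrow> real" where
  "heat_symbol s = exp (- (s\<^sup>2) * T)"

definition heat :: "'a \<Rightarrow> 'a" where
  "heat = spectral_fun H E heat_symbol"

text \<open>The non-negative inverse of \<open>heat_symbol\<close>, turning a height
  \<open>r\<close> in (0,1] into the spectral cut-off at which the symbol equals
  \<open>r\<close>.\<close>

definition level :: "real \<Rightarrow> real" where
  "level r = sqrt (- ln r / T)"

lemma le_level_iff:
  assumes "0 < r" "0 \<le> s"
  shows "s \<le> level r \<longleftrightarrow> r \<le> heat_symbol s"
proof -
  have "s \<le> level r \<longleftrightarrow> s\<^sup>2 \<le> - ln r / T"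
    using assms unfolding level_def by (metis real_sqrt_abs abs_of_nonneg real_sqrt_le_iff)
  also have "\<dots> \<longleftrightarrow> ln r \<le> - (s\<^sup>2) * T"
    using T_pos by (auto simp: field_simps)
  also have "\<dots> \<longleftrightarrow> r \<le> heat_symbol s"
    using assms unfolding heat_symbol_def by (metis exp_le_cancel_iff exp_ln)
  finally show ?thesis .
qed

lemma heat_symbol_le_1: "heat_symbol s \<le> 1"
  using T_pos by (simp add: heat_symbol_def)

lemma heat_symbol_pos [simp]: "0 < heat_symbol s"
  by (simp add: heat_symbol_def)

lemma heat_symbol_nonneg [simp]: "0 \<le> heat_symbol s"
  by (simp add: heat_symbol_def)

lemma heat_symbol_borel [measurable]: "heat_symbol \<in> borel_measurable borel"
  unfolding heat_symbol_def by measurable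

lemma level_borel [measurable]: "level \<in> borel_measurable borel"
  unfolding level_def by measurable

lemma borel_measurable_level_family:
  assumes "\<phi> \<in> H" "\<psi> \<in> H"
  shows "(\<lambda>r. inner (E (level r) \<phi>) \<psi>) \<in> borel_measurable unit_measure"
  by (rule borel_measurable_unit_measure)
    (rule measurable_compose[OF level_borel borel_measurable_inner_E[OF assms]])

lemma abs_inner_E_le:
  assumes "\<phi> \<in> H"
  shows "\<bar>inner (E s \<phi>) \<psi>\<bar> \<le> norm \<phi> * norm \<psi>"
  using Cauchy_Schwarz_ineq2[of "E s \<phi>" \<psi>] mult_right_mono[OF norm_E_le[OF assms, of s], of "norm \<psi>"] by simp

lemma integrable_level_family:
  assumes "\<phi> \<in> H" "\<psi> \<in> H"
  shows "integrable unit_measure (\<lambda>r. inner (E (level r) \<phi>) \<psi>)"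
proof -
  interpret finite_measure unit_measure by (rule finite_measure_unit_measure)
  show ?thesis
    using abs_inner_E_le[OF assms(1)]
    by (intro integrable_const_bound[of _ "norm \<phi> * norm \<psi>"] borel_measurable_level_family assms) auto
qed

text \<open>Layer-cake formula: \<open>exp (-s\<^sup>2T)\<close> is the length of \<open>{r \<in> (0,1]. r \<le> exp (-s\<^sup>2T)}\<close>.\<close>

lemma integral_heat_symbol:
  assumes "\<phi> \<in> H"
  shows "(\<integral>s. heat_symbol s \<partial>spectral_measure E \<phi>) = (\<integral>r. inner (E (level r) \<phi>) \<phi> \<partial>unit_measure)"
proof -
  define \<mu> where "\<mu> = spectral_measure E \<phi>"
  have sets [measurable_cong]: "sets \<mu> = sets borel" and [simp]: "space \<mu> = UNIV"
    by (auto simp: \<mu>_def)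
  interpret \<mu>: finite_measure \<mu>
    unfolding \<mu>_def by (rule finite_measure_spectral_measure[OF assms])
  interpret U: finite_measure unit_measure
    by (rule finite_measure_unit_measure)
  interpret pair_sigma_finite unit_measure \<mu> ..
  \<comment> \<open>The symbol is even, so its superlevel sets are symmetric intervals, whereas
    \<open>E (level r)\<close> measures a half-line. The two agree because the gap removes all mass
    from the non-positive axis.\<close>
  have null: "emeasure \<mu> {..0} = 0"
    unfolding \<mu>_def using gap[OF l_pos assms] emeasure_spectral_measure_Iic[OF assms, of 0] by simp
  have U_id: "(\<lambda>r. r) \<in> borel_measurable unit_measure"
    by (rule borel_measurable_unit_measure) simp
  have meas: "(\<lambda>(r, s). indicator {r. r \<le> heat_symbol s} r :: ennreal) \<in> borel_measurable (unit_measure \<Otimes>\<^sub>M \<mu>)"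
  proof -
    have "(\<lambda>x. fst x) \<in> borel_measurable (unit_measure \<Otimes>\<^sub>M \<mu>)"
      by (rule measurable_compose[OF measurable_fst U_id])
    moreover have "(\<lambda>x. heat_symbol (snd x)) \<in> borel_measurable (unit_measure \<Otimes>\<^sub>M \<mu>)"
      by measurable
    ultimately have "{x \<in> space (unit_measure \<Otimes>\<^sub>M \<mu>). fst x \<le> heat_symbol (snd x)} \<in> sets (unit_measure \<Otimes>\<^sub>M \<mu>)"
      by (rule borel_measurable_le)
    then have "(\<lambda>x. indicator {x \<in> space (unit_measure \<Otimes>\<^sub>M \<mu>). fst x \<le> heat_symbol (snd x)} x :: ennreal)
        \<in> borel_measurable (unit_measure \<Otimes>\<^sub>M \<mu>)"
      by (rule borel_measurable_indicator)
    then show ?thesis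
      by (rule measurable_cong[THEN iffD1, rotated]) (auto simp: indicator_def)
  qed
  have inner_r: "(\<integral>\<^sup>+r. indicator {r. r \<le> heat_symbol s} r \<partial>unit_measure) = ennreal (heat_symbol s)" for s
  proof -
    have "(\<integral>\<^sup>+r. indicator {r. r \<le> heat_symbol s} r \<partial>unit_measure) =
        (\<integral>\<^sup>+r. indicator {0<..heat_symbol s} r \<partial>unit_measure)"
      by (rule nn_integral_cong) (auto simp: indicator_def)
    also have "\<dots> = ennreal (heat_symbol s)"
      using heat_symbol_le_1[of s]
      by (subst nn_integral_indicator) (auto intro: emeasure_unit_measure_atMost sets_unit_measure_atMost)
    finally show ?thesis .
  qed
  have inner_s: "(\<integral>\<^sup>+s. indicator {r. r \<le> heat_symbol s} r \<partial>\<mu>) = ennreal (inner (E (level r) \<phi>) \<phi>)"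
    if "r \<in> space unit_measure" for r
  proof -
    have r: "0 < r" "r \<le> 1" using that by auto
    have "0 \<le> level r"
      using le_level_iff[of r 0] r by (simp add: heat_symbol_def)
    have iff: "r \<le> heat_symbol s \<longleftrightarrow> - level r \<le> s \<and> s \<le> level r" for s
    proof -
      have "r \<le> heat_symbol s \<longleftrightarrow> \<bar>s\<bar> \<le> level r"
        using le_level_iff[of r "\<bar>s\<bar>"] r by (simp add: heat_symbol_def)
      then show ?thesis
        unfolding abs_le_iff by linarith
    qed
    have "(\<integral>\<^sup>+s. indicator {r. r \<le> heat_symbol s} r \<partial>\<mu>) = (\<integral>\<^sup>+s. indicator {- level r..level r} s \<partial>\<mu>)"
      by (rule nn_integral_cong) (simp add: indicator_def iff)
    also have "\<dots> = emeasure \<mu> {- level r..level r}"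
      by (rule nn_integral_indicator) (simp add: sets)
    also have "\<dots> = emeasure \<mu> {..level r}"
    proof (rule antisym)
      show "emeasure \<mu> {- level r..level r} \<le> emeasure \<mu> {..level r}"
        by (rule emeasure_mono) (auto simp: sets)
      have "emeasure \<mu> {..level r} \<le> emeasure \<mu> ({- level r..level r} \<union> {..0})"
        using \<open>0 \<le> level r\<close> by (intro emeasure_mono) (auto simp: sets)
      also have "\<dots> \<le> emeasure \<mu> {- level r..level r} + emeasure \<mu> {..0}"
        by (rule emeasure_subadditive) (auto simp: sets)
      finally show "emeasure \<mu> {..level r} \<le> emeasure \<mu> {- level r..level r}"
        by (simp add: null)
    qed
    finally show ?thesis
      by (simp add: \<mu>_def emeasure_spectral_measure_Iic[OF assms])
  qed
  have "(\<integral>\<^sup>+s. ennreal (heat_symbol s) \<partial>\<mu>) =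
      (\<integral>\<^sup>+s. \<integral>\<^sup>+r. indicator {r. r \<le> heat_symbol s} r \<partial>unit_measure \<partial>\<mu>)"
    by (simp add: inner_r)
  also have "\<dots> = (\<integral>\<^sup>+r. \<integral>\<^sup>+s. indicator {r. r \<le> heat_symbol s} r \<partial>\<mu> \<partial>unit_measure)"
    by (rule Fubini'[OF meas])
  also have "\<dots> = (\<integral>\<^sup>+r. ennreal (inner (E (level r) \<phi>) \<phi>) \<partial>unit_measure)"
    by (rule nn_integral_cong) (rule inner_s)
  finally have nn: "(\<integral>\<^sup>+s. ennreal (heat_symbol s) \<partial>\<mu>) = (\<integral>\<^sup>+r. ennreal (inner (E (level r) \<phi>) \<phi>) \<partial>unit_measure)" .
  have "(\<integral>s. heat_symbol s \<partial>\<mu>) = enn2real (\<integral>\<^sup>+s. ennreal (heat_symbol s) \<partial>\<mu>)"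
    by (rule integral_eq_nn_integral) auto
  also have "\<dots> = (\<integral>r. inner (E (level r) \<phi>) \<phi> \<partial>unit_measure)"
    unfolding nn using borel_measurable_level_family[OF assms assms]
    by (intro integral_eq_nn_integral[symmetric]) (auto simp: inner_E_self[OF assms])
  finally show ?thesis
    by (simp add: \<mu>_def)
qed

lemma spectral_form_heat:
  assumes "\<phi> \<in> H" "\<psi> \<in> H"
  shows "spectral_form E heat_symbol \<phi> \<psi> = (\<integral>r. inner (E (level r) \<phi>) \<psi> \<partial>unit_measure)"
proof -
  have "(\<integral>r. inner (E (level r) \<phi>) \<psi> \<partial>unit_measure) =
    ((\<integral>r. inner (E (level r) (\<phi> + \<psi>)) (\<phi> + \<psi>) \<partial>unit_measure) -
     (\<integral>r. inner (E (level r) (\<phi> - \<psi>)) (\<phi> - \<psi>) \<partial>unit_measure)) / 4"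
    unfolding inner_E_polar[OF assms] using assms
    by (simp add: integrable_level_family)
  then show ?thesis
    unfolding spectral_form_def using assms by (simp add: integral_heat_symbol)
qed

lemma spectral_domain_heat: "spectral_domain H E heat_symbol = H"
proof -
  have "(\<integral>\<^sup>+s. ennreal ((heat_symbol s)\<^sup>2) \<partial>spectral_measure E \<phi>) < \<infinity>" if "\<phi> \<in> H" for \<phi>
  proof -
    have "(\<integral>\<^sup>+s. ennreal ((heat_symbol s)\<^sup>2) \<partial>spectral_measure E \<phi>) \<le> (\<integral>\<^sup>+s. 1 \<partial>spectral_measure E \<phi>)"
      using heat_symbol_le_1 by (intro nn_integral_mono) (auto simp: power_le_one)
    also have "\<dots> < \<infinity>"
      by (simp add: emeasure_spectral_measure_UNIV[OF that])
    finally show ?thesis .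
  qed
  then show ?thesis
    by (auto simp: spectral_domain_def)
qed

lemma inner_eqI:
  assumes "\<eta> \<in> H" "\<eta>' \<in> H" "\<And>\<psi>. \<psi> \<in> H \<Longrightarrow> inner \<eta> \<psi> = inner \<eta>' \<psi>"
  shows "\<eta> = \<eta>'"
proof -
  have "inner (\<eta> - \<eta>') (\<eta> - \<eta>') = 0"
    using assms(3)[of "\<eta> - \<eta>'"] assms(1,2) by (simp add: inner_diff_left)
  then show ?thesis by simp
qed

text \<open>Nothing can be said about the definite description \<open>heat\<close> until its value
  is known to exist uniquely. Since the symbol is at most 1, all of \<open>H\<close> serves as test
  space; the averaged form is bounded by the product of the norms, so Riesz gives existence. The
  properties below are then read off from this average of projections.\<close>

lemma heat_characterisation:
  assumes "\<phi> \<in> H"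
  shows "heat \<phi> \<in> H \<and> (\<forall>\<psi>\<in>H. inner (heat \<phi>) \<psi> = (\<integral>r. inner (E (level r) \<phi>) \<psi> \<partial>unit_measure))"
proof -
  define b where "b \<psi> = (\<integral>r. inner (E (level r) \<phi>) \<psi> \<partial>unit_measure)" for \<psi>
  interpret U: finite_measure unit_measure
    by (rule finite_measure_unit_measure)
  have "\<exists>\<eta>\<in>H. \<forall>\<psi>\<in>H. inner \<eta> \<psi> = b \<psi>"
  proof (rule Riesz_representation[OF subspace_H complete_H])
    show "b (\<psi> + \<psi>') = b \<psi> + b \<psi>'" if "\<psi> \<in> H" "\<psi>' \<in> H" for \<psi> \<psi>'
      using that assms by (simp add: b_def inner_add_right integrable_level_family)
    show "b (c *\<^sub>R \<psi>) = c * b \<psi>" for c \<psi>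
      by (simp add: b_def)
    show "\<bar>b \<psi>\<bar> \<le> norm \<phi> * norm \<psi>" if "\<psi> \<in> H" for \<psi>
    proof -
      have "\<bar>b \<psi>\<bar> \<le> (\<integral>r. \<bar>inner (E (level r) \<phi>) \<psi>\<bar> \<partial>unit_measure)"
        unfolding b_def using integral_norm_bound[of unit_measure "\<lambda>r. inner (E (level r) \<phi>) \<psi>"] by simp
      also have "\<dots> \<le> (\<integral>r. norm \<phi> * norm \<psi> \<partial>unit_measure)"
        using abs_inner_E_le[OF assms] integrable_level_family[OF assms that]
        by (intro integral_mono) auto
      also have "\<dots> = norm \<phi> * norm \<psi>"
        using measure_unit_measure_UNIV by simp
      finally show ?thesis .
    qed
  qed
  then obtain \<eta> where \<eta>: "\<eta> \<in> H" "\<And>\<psi>. \<psi> \<in> H \<Longrightarrow> inner \<eta> \<psi> = b \<psi>" by blast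
  have value_iff: "spectral_value H E heat_symbol \<phi> \<zeta> \<longleftrightarrow> \<zeta> \<in> H \<and> (\<forall>\<psi>\<in>H. inner \<zeta> \<psi> = b \<psi>)" for \<zeta>
    unfolding spectral_value_def spectral_domain_heat using assms by (auto simp: spectral_form_heat b_def)
  have "heat \<phi> = \<eta>"
    unfolding heat_def spectral_fun_def value_iff using \<eta> by (intro the_equality inner_eqI) auto
  with \<eta> show ?thesis by (simp add: b_def)
qed

section \<open>Algebra and two-sided bounds of the heat operator\<close>

lemma heat_in [simp]: "\<phi> \<in> H \<Longrightarrow> heat \<phi> \<in> H"
  using heat_characterisation by blast

lemma inner_heat:
  "\<phi> \<in> H \<Longrightarrow> \<psi> \<in> H \<Longrightarrow> inner (heat \<phi>) \<psi> = (\<integral>r. inner (E (level r) \<phi>) \<psi> \<partial>unit_measure)"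
  using heat_characterisation by blast

lemma heat_diff: "\<phi> \<in> H \<Longrightarrow> \<psi> \<in> H \<Longrightarrow> heat (\<phi> - \<psi>) = heat \<phi> - heat \<psi>"
  by (rule inner_eqI) (simp_all add: inner_diff_left inner_heat E_diff integrable_level_family)

lemma heat_scale: "\<phi> \<in> H \<Longrightarrow> heat (c *\<^sub>R \<phi>) = c *\<^sub>R heat \<phi>"
  by (rule inner_eqI) (simp_all add: inner_heat E_scale)

lemma heat_sym:
  assumes "\<phi> \<in> H" "\<psi> \<in> H"
  shows "inner (heat \<phi>) \<psi> = inner \<phi> (heat \<psi>)"
proof -
  have "inner (E s \<phi>) \<psi> = inner (E s \<psi>) \<phi>" for s
    unfolding inner_commute[of "E s \<psi>" \<phi>] by (rule E_sym[OF assms])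
  then show ?thesis
    unfolding inner_commute[of \<phi> "heat \<psi>"] inner_heat[OF assms] inner_heat[OF assms(2,1)]
    by (simp only:)
qed

lemma heat_E:
  assumes "\<phi> \<in> H"
  shows "heat (E s \<phi>) = E s (heat \<phi>)"
proof (rule inner_eqI)
  fix \<psi> assume \<psi>: "\<psi> \<in> H"
  have "E t (E s \<phi>) = E s (E t \<phi>)" for t
    using E_E[OF assms] by (simp add: min.commute)
  then show "inner (heat (E s \<phi>)) \<psi> = inner (E s (heat \<phi>)) \<psi>"
    using assms \<psi> by (simp add: inner_heat E_sym)
qed (use assms in auto)

text \<open>By the gap, only parameters with \<open>level r\<close> at least \<open>l\<close>
  contribute to the average, and they form an interval of length
  \<open>heat_symbol l\<close>.\<close>

lemma heat_upper:
  assumes "\<phi> \<in> H"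
  shows "inner (heat \<phi>) \<phi> \<le> heat_symbol l * (norm \<phi>)\<^sup>2"
proof -
  have "inner (heat \<phi>) \<phi> \<le> (\<integral>r. (if r \<le> heat_symbol l then (norm \<phi>)\<^sup>2 else 0) \<partial>unit_measure)"
    unfolding inner_heat[OF assms assms]
  proof (rule integral_mono[OF integrable_level_family[OF assms assms]])
    show "integrable unit_measure (\<lambda>r. if r \<le> heat_symbol l then (norm \<phi>)\<^sup>2 else 0)"
      using heat_symbol_le_1[of l] by (intro integrable_unit_measure_step) auto
    fix r assume "r \<in> space unit_measure"
    then have "0 < r" by simp
    show "inner (E (level r) \<phi>) \<phi> \<le> (if r \<le> heat_symbol l then (norm \<phi>)\<^sup>2 else 0)"
      using le_level_iff[OF \<open>0 < r\<close>, of l] l_pos gap[of "level r", OF _ assms] norm_E_le[OF assms, of "level r"]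
      by (auto simp: inner_E_self[OF assms] intro!: power_mono)
  qed
  also have "\<dots> = heat_symbol l * (norm \<phi>)\<^sup>2"
    using heat_symbol_le_1[of l] by (intro integral_unit_measure_step) auto
  finally show ?thesis .
qed

text \<open>On the range of \<open>E s\<close> the projection \<open>E (level r)\<close> acts as the
  identity once \<open>level r\<close> reaches \<open>s\<close>, which happens on an interval of
  length \<open>heat_symbol s\<close>.\<close>

lemma heat_lower:
  assumes "\<phi> \<in> H" "0 \<le> s" "E s \<phi> = \<phi>"
  shows "heat_symbol s * (norm \<phi>)\<^sup>2 \<le> inner (heat \<phi>) \<phi>"
proof -
  have "heat_symbol s * (norm \<phi>)\<^sup>2 = (\<integral>r. (if r \<le> heat_symbol s then (norm \<phi>)\<^sup>2 else 0) \<partial>unit_measure)"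
    using heat_symbol_le_1[of s] by (intro integral_unit_measure_step[symmetric]) auto
  also have "\<dots> \<le> (\<integral>r. inner (E (level r) \<phi>) \<phi> \<partial>unit_measure)"
  proof (rule integral_mono[OF _ integrable_level_family[OF assms(1,1)]])
    show "integrable unit_measure (\<lambda>r. if r \<le> heat_symbol s then (norm \<phi>)\<^sup>2 else 0)"
      using heat_symbol_le_1[of s] by (intro integrable_unit_measure_step) auto
    fix r assume "r \<in> space unit_measure"
    then have "0 < r" by simp
    have "E (level r) \<phi> = \<phi>" if "s \<le> level r"
      using E_E[OF assms(1), of "level r" s] that assms(3) by (simp add: min_absorb2)
    then show "(if r \<le> heat_symbol s then (norm \<phi>)\<^sup>2 else 0) \<le> inner (E (level r) \<phi>) \<phi>"
      using le_level_iff[OF \<open>0 < r\<close> assms(2)] by (auto simp: inner_E_self[OF assms(1)])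
  qed
  finally show ?thesis
    by (simp add: inner_heat assms)
qed

lemma heat_nonneg: "\<phi> \<in> H \<Longrightarrow> 0 \<le> inner (heat \<phi>) \<phi>"
  by (simp add: inner_heat inner_E_self)

text \<open>This is the operator inequality \<open>K^2 <= \<kappa> K\<close>, obtained without
  square roots of operators. The non-negative form of \<open>K\<close> is evaluated at
  \<open>\<phi> - c K \<phi>\<close> and its last term is estimated by \<open>heat_upper\<close> at
  \<open>K \<phi>\<close>; \<open>c = 1 / \<kappa>\<close> minimises the resulting bound.\<close>

lemma norm_heat_le:
  assumes "\<phi> \<in> H"
  shows "(norm (heat \<phi>))\<^sup>2 \<le> heat_symbol l * inner (heat \<phi>) \<phi>"
proof -
  define \<kappa> where "\<kappa> = heat_symbol l"
  have "0 < \<kappa>" by (simp add: \<kappa>_def)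
  define \<eta> where "\<eta> = heat \<phi>"
  have \<eta>: "\<eta> \<in> H" by (simp add: \<eta>_def assms)
  have \<eta>\<phi>: "inner (heat \<eta>) \<phi> = inner \<eta> \<eta>"
    using heat_sym[OF \<eta> assms] by (simp add: \<eta>_def)
  have expand: "inner (heat (\<phi> - c *\<^sub>R \<eta>)) (\<phi> - c *\<^sub>R \<eta>) =
      inner \<eta> \<phi> - 2 * (c * inner \<eta> \<eta>) + c * (c * inner (heat \<eta>) \<eta>)" for c
  proof -
    have "heat (\<phi> - c *\<^sub>R \<eta>) = \<eta> - c *\<^sub>R heat \<eta>"
      using assms \<eta> by (simp only: heat_diff heat_scale H_scale \<eta>_def)
    then show ?thesis
      by (simp add: inner_diff_left inner_diff_right \<eta>\<phi> right_diff_distrib)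
  qed
  have "0 \<le> inner (heat (\<phi> - (1/\<kappa>) *\<^sub>R \<eta>)) (\<phi> - (1/\<kappa>) *\<^sub>R \<eta>)"
    using assms \<eta> by (intro heat_nonneg) simp
  also have "\<dots> = inner \<eta> \<phi> - 2 * ((1/\<kappa>) * inner \<eta> \<eta>) + (1/\<kappa>) * ((1/\<kappa>) * inner (heat \<eta>) \<eta>)"
    by (rule expand)
  also have "\<dots> \<le> inner \<eta> \<phi> - 2 * ((1/\<kappa>) * inner \<eta> \<eta>) + (1/\<kappa>) * ((1/\<kappa>) * (\<kappa> * inner \<eta> \<eta>))"
    using heat_upper[OF \<eta>] \<open>0 < \<kappa>\<close>
    by (intro add_left_mono mult_left_mono) (auto simp: \<kappa>_def power2_norm_eq_inner)
  also have "\<dots> = inner \<eta> \<phi> - (norm \<eta>)\<^sup>2 / \<kappa>"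
    using \<open>0 < \<kappa>\<close> by (simp add: power2_norm_eq_inner)
  finally show ?thesis
    using \<open>0 < \<kappa>\<close> by (simp add: field_simps \<eta>_def \<kappa>_def[symmetric])
qed

text \<open>A kernel vector is cut off by \<open>E s\<close>, which commutes with
  \<open>heat\<close>; the lower bound kills each cut-off piece, and these pieces converge to the
  vector.\<close>

lemma heat_inj:
  assumes "\<phi> \<in> H" "heat \<phi> = 0"
  shows "\<phi> = 0"
proof -
  have "E s \<phi> = 0" if "0 \<le> s" for s
  proof -
    have "heat (E s \<phi>) = 0"
      using assms E_scale[OF assms(1), of s 0] E_diff[OF assms(1,1), of s] heat_E[OF assms(1), of s]
        E_diff[of "heat \<phi>" "heat \<phi>" s] by simp
    then have "heat_symbol s * (norm (E s \<phi>))\<^sup>2 \<le> 0"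
      using heat_lower[of "E s \<phi>" s] assms(1) that by (simp add: E_E)
    then have "(norm (E s \<phi>))\<^sup>2 \<le> 0"
      using heat_symbol_pos[of s] by (metis mult_pos_pos not_le)
    then show ?thesis by simp
  qed
  then have "((\<lambda>s. E s \<phi>) \<longlongrightarrow> 0) at_top"
    by (intro tendsto_eventually) (auto simp: eventually_at_top_linorder)
  then show ?thesis
    using tendsto_unique[OF _ E_at_top[OF assms(1)]] by force
qed

text \<open>The non-negativity of \<open>s\<close> matters because \<open>level\<close> selects the
  non-negative root of an even symbol.\<close>

lemma heat_eigen:
  assumes "p \<in> H" "0 \<le> s" "\<And>t. E t p = (if t < s then 0 else p)"
  shows "heat p = heat_symbol s *\<^sub>R p"
proof (rule inner_eqI)
  fix \<psi> assume \<psi>: "\<psi> \<in> H"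
  have "inner (heat p) \<psi> = (\<integral>r. (if r \<le> heat_symbol s then inner p \<psi> else 0) \<partial>unit_measure)"
    unfolding inner_heat[OF assms(1) \<psi>]
    by (intro Bochner_Integration.integral_cong refl)
      (auto simp: assms(3) le_level_iff[OF _ assms(2), symmetric])
  then show "inner (heat p) \<psi> = inner (heat_symbol s *\<^sub>R p) \<psi>"
    using integral_unit_measure_step[OF _ heat_symbol_le_1[of s], of "inner p \<psi>"] by simp
qed (use assms in auto)

end

section \<open>Self-adjoint operators with discrete spectrum\<close>

locale spectral_operator = spectral_space H E
  for H :: "'h::real_inner set" and E :: "real \<Rightarrow> 'h \<Rightarrow> 'h" +
  fixes D :: "'h set" and L :: "'h \<Rightarrow> 'h"
  assumes linear_L: "linear_operator H D L"
    and D_eq: "D = spectral_domain H E (\<lambda>s. s)"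
    and L_value: "\<And>\<phi>. \<phi> \<in> D \<Longrightarrow> spectral_value H E (\<lambda>s. s) \<phi> (L \<phi>)"
begin

lemma D_subset: "\<phi> \<in> D \<Longrightarrow> \<phi> \<in> H"
  using linear_L by (auto simp: linear_operator_def)

lemma L_in: "\<phi> \<in> D \<Longrightarrow> L \<phi> \<in> H"
  using linear_L by (auto simp: linear_operator_def)

lemma inner_L:
  "\<phi> \<in> D \<Longrightarrow> \<psi> \<in> D \<Longrightarrow> inner (L \<phi>) \<psi> =
    ((\<integral>s. s \<partial>spectral_measure E (\<phi> + \<psi>)) - (\<integral>s. s \<partial>spectral_measure E (\<phi> - \<psi>))) / 4"
  using L_value D_eq by (auto simp: spectral_value_def spectral_form_def)

lemma AE_spectral_measure_jump:
  assumes p: "p \<in> H" "E a p = 0" "E b p = p"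
  shows "AE s in spectral_measure E p. s \<in> {a<..b}"
proof -
  let ?\<mu> = "spectral_measure E p"
  interpret finite_measure ?\<mu>
    by (rule finite_measure_spectral_measure[OF p(1)])
  have "emeasure ?\<mu> {..a} = 0"
    using p by (simp add: emeasure_spectral_measure_Iic)
  moreover have "emeasure ?\<mu> (UNIV - {..b}) = 0"
    using p emeasure_Diff[of ?\<mu> "{..b}" UNIV]
    by (simp add: emeasure_spectral_measure_Iic emeasure_spectral_measure_UNIV power2_norm_eq_inner)
  ultimately have "{..a} \<in> null_sets ?\<mu>" "UNIV - {..b} \<in> null_sets ?\<mu>"
    by (auto simp: null_sets_def)
  then have "AE s in ?\<mu>. s \<notin> {..a}" "AE s in ?\<mu>. s \<notin> UNIV - {..b}"
    by (auto dest: AE_not_in)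
  then show ?thesis
    by eventually_elim auto
qed

lemma jump_in_D:
  assumes p: "p \<in> H" "E a p = 0" "E b p = p"
  shows "p \<in> D"
proof -
  have "(\<integral>\<^sup>+s. ennreal (s\<^sup>2) \<partial>spectral_measure E p) \<le> (\<integral>\<^sup>+s. ennreal (a\<^sup>2 + b\<^sup>2) \<partial>spectral_measure E p)"
  proof (rule nn_integral_mono_AE, use AE_spectral_measure_jump[OF p] in eventually_elim)
    case (elim s)
    then have "\<bar>s\<bar> \<le> max \<bar>a\<bar> \<bar>b\<bar>" by auto
    then have "s\<^sup>2 \<le> (max \<bar>a\<bar> \<bar>b\<bar>)\<^sup>2"
      by (metis abs_ge_zero power2_abs power_mono)
    also have "\<dots> \<le> a\<^sup>2 + b\<^sup>2"
      by (auto simp: max_def)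
    finally show ?case by (rule ennreal_leI)
  qed
  also have "\<dots> < \<infinity>"
    using p by (simp add: emeasure_spectral_measure_UNIV ennreal_mult_less_top)
  finally show ?thesis
    using p by (simp add: D_eq spectral_domain_def)
qed

text \<open>If \<open>\<langle>E\<^sub>t \<phi>, \<psi>\<rangle> = 0\<close> for all \<open>t\<close>, then \<open>\<phi> + \<psi>\<close> and \<open>\<phi> - \<psi>\<close> have the same spectral measure.\<close>

lemma inner_L_spectrally_orthogonal:
  assumes "\<phi> \<in> D" "\<psi> \<in> D" "\<And>t. inner (E t \<phi>) \<psi> = 0"
  shows "inner (L \<phi>) \<psi> = 0"
proof -
  have "inner (E t (\<phi> + \<psi>)) (\<phi> + \<psi>) = inner (E t (\<phi> - \<psi>)) (\<phi> - \<psi>)" for t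
    using inner_E_polar[of \<phi> \<psi> t] assms D_subset by simp
  then show ?thesis
    by (simp add: inner_L assms spectral_measure_def)
qed

text \<open>The spectral measure of such a \<open>q\<close> lives on the window, where the integrand
  differs from \<open>c\<close> by at most \<open>\<epsilon>\<close>. This is the quadratic form of
  \<open>L - c\<close> in the weak language available here.\<close>

lemma integral_shift_jump:
  assumes q: "q \<in> H" "E a q = 0" "E b q = q" and c: "\<And>s. s \<in> {a<..b} \<Longrightarrow> \<bar>s - c\<bar> \<le> \<epsilon>"
  shows "\<bar>(\<integral>s. s \<partial>spectral_measure E q) - c * (norm q)\<^sup>2\<bar> \<le> \<epsilon> * (norm q)\<^sup>2"
proof -
  let ?\<mu> = "spectral_measure E q"
  interpret finite_measure ?\<mu>
    by (rule finite_measure_spectral_measure[OF q(1)])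
  have AE: "AE s in ?\<mu>. \<bar>s - c\<bar> \<le> \<epsilon>"
    using AE_spectral_measure_jump[OF q] by eventually_elim (rule c)
  have int: "integrable ?\<mu> (\<lambda>s. s - c)"
    using AE by (intro integrable_const_bound[of _ \<epsilon>]) auto
  have "integrable ?\<mu> (\<lambda>s. (s - c) + c)"
    by (rule Bochner_Integration.integrable_add[OF int]) simp
  then have int': "integrable ?\<mu> (\<lambda>s. s)" by simp
  have "(\<integral>s. s \<partial>?\<mu>) - c * (norm q)\<^sup>2 = (\<integral>s. s - c \<partial>?\<mu>)"
    using int' measure_spectral_measure_UNIV[OF q(1)] by simp
  also have "\<bar>\<dots>\<bar> \<le> (\<integral>s. \<bar>s - c\<bar> \<partial>?\<mu>)"
    using integral_norm_bound[of ?\<mu> "\<lambda>s. s - c"] by simp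
  also have "\<dots> \<le> (\<integral>s. \<epsilon> \<partial>?\<mu>)"
    using AE int by (intro integral_mono_AE) auto
  also have "\<dots> = \<epsilon> * (norm q)\<^sup>2"
    using measure_spectral_measure_UNIV[OF q(1)] by simp
  finally show ?thesis .
qed

lemma E_jump:
  assumes "\<phi> \<in> H" "a \<le> b"
  shows "E t (E b \<phi> - E a \<phi>) = (if t \<le> a then 0 else if t \<le> b then E t \<phi> - E a \<phi> else E b \<phi> - E a \<phi>)"
  using assms by (simp add: E_diff E_E min_def)

text \<open>A vector from a narrow spectral window is an approximate eigenvector. The residual
  \<open>\<eta> = L p - c p\<close> need not lie in \<open>D\<close>, so it cannot be tested against
  itself; its part \<open>\<psi>\<close> in the window can. \<open>below\<close> and
  \<open>above\<close> show that \<open>\<eta>\<close> has no component outside the window, so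
  testing with \<open>\<psi>\<close> still yields the squared norm of \<open>\<eta>\<close>.\<close>

lemma jump_estimate:
  assumes p: "p \<in> H" "E a p = 0" "E b p = p" and "a < b" "0 < \<epsilon>"
    and c: "\<And>s. s \<in> {a<..b} \<Longrightarrow> \<bar>s - c\<bar> \<le> \<epsilon>"
  shows "norm (L p - c *\<^sub>R p) \<le> \<epsilon> * norm p"
proof -
  have pD: "p \<in> D" by (rule jump_in_D[OF p])
  define \<eta> where "\<eta> = L p - c *\<^sub>R p"
  have \<eta>: "\<eta> \<in> H"
    using pD L_in p(1) by (simp add: \<eta>_def)
  have Ep: "E t p = 0" if "t \<le> a" for t
    using E_E[OF p(1), of t a] E_scale[OF p(1), of t 0] p(2) that by (simp add: min_absorb1)
  have Ep': "E t p = p" if "b \<le> t" for t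
    using E_E[OF p(1), of t b] p(3) that by (simp add: min_absorb2)
  define \<psi> where "\<psi> = E b \<eta> - E a \<eta>"
  have \<psi>: "\<psi> \<in> H" "E a \<psi> = 0" "E b \<psi> = \<psi>"
    using \<eta> \<open>a < b\<close> by (auto simp: \<psi>_def E_jump)
  have jumpD: "E y \<eta> - E x \<eta> \<in> D" if "x \<le> y" for x y
    using \<eta> that by (intro jump_in_D[of _ x y]) (auto simp: E_jump)
  \<comment> \<open>A bounded spectral slice of \<open>\<eta>\<close> lies in \<open>D\<close> and
    is spectrally orthogonal to \<open>p\<close>, hence orthogonal both to \<open>L p\<close> and to
    \<open>p\<close>.\<close>
  have below: "inner \<eta> (E a \<eta> - E x \<eta>) = 0" if "x \<le> a" for x
  proof -
    have orth: "inner (E t p) (E a \<eta> - E x \<eta>) = 0" for t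
    proof -
      have "inner (E t p) (E a \<eta> - E x \<eta>) = inner (E a (E t p)) \<eta> - inner (E x (E t p)) \<eta>"
        using \<eta> p(1) by (simp add: inner_diff_right E_sym)
      then show ?thesis
        using p(1) that by (simp add: E_E Ep)
    qed
    then show ?thesis
      using inner_L_spectrally_orthogonal[OF pD jumpD[OF that]] orth[of b] p(3)
      by (simp add: \<eta>_def[symmetric] inner_diff_left) (simp add: \<eta>_def inner_diff_left)
  qed
  have above: "inner \<eta> (E y \<eta> - E b \<eta>) = 0" if "b \<le> y" for y
  proof -
    have orth: "inner (E t p) (E y \<eta> - E b \<eta>) = 0" for t
    proof -
      have "inner (E t p) (E y \<eta> - E b \<eta>) = inner (E y (E t p)) \<eta> - inner (E b (E t p)) \<eta>"
        using \<eta> p(1) by (simp add: inner_diff_right E_sym)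
      moreover have "E y (E t p) = E b (E t p)"
        using that by (cases "t \<le> b") (simp_all add: E_E[OF p(1)] Ep' min_absorb2)
      ultimately show ?thesis by simp
    qed
    then show ?thesis
      using inner_L_spectrally_orthogonal[OF pD jumpD[OF that]] orth[of b] p(3)
      by (simp add: \<eta>_def[symmetric] inner_diff_left) (simp add: \<eta>_def inner_diff_left)
  qed
  \<comment> \<open>Exhausting the line by the windows from \<open>- n\<close> to \<open>n\<close>
    recovers \<open>\<eta>\<close> in the limit, although \<open>\<eta>\<close> itself is no
    admissible test vector.\<close>
  have "inner \<eta> (E (real n) \<eta> - E (- real n) \<eta>) = inner \<eta> \<psi>" if "\<bar>a\<bar> + \<bar>b\<bar> \<le> real n" for n
    using below[of "- real n"] above[of "real n"] that by (simp add: \<psi>_def inner_diff_right)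
  then have "eventually (\<lambda>n. inner \<eta> (E (real n) \<eta> - E (- real n) \<eta>) = inner \<eta> \<psi>) sequentially"
    by (intro eventually_sequentiallyI[of "nat \<lceil>\<bar>a\<bar> + \<bar>b\<bar>\<rceil>"]) (simp add: nat_ceiling_le_eq)
  then have "(\<lambda>n. inner \<eta> (E (real n) \<eta> - E (- real n) \<eta>)) \<longlonglongrightarrow> inner \<eta> \<psi>"
    by (rule tendsto_eventually)
  moreover have "(\<lambda>n. inner \<eta> (E (real n) \<eta> - E (- real n) \<eta>)) \<longlonglongrightarrow> inner \<eta> (\<eta> - 0)"
    by (intro tendsto_intros E_at_top[OF \<eta>, THEN filterlim_compose] E_at_bot[OF \<eta>, THEN filterlim_compose]
        filterlim_real_sequentially filterlim_uminus_at_top[THEN iffD1])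
  ultimately have \<eta>\<psi>: "inner \<eta> \<psi> = (norm \<eta>)\<^sup>2"
    using LIMSEQ_unique by (fastforce simp: power2_norm_eq_inner)
  have norm_\<psi>: "(norm \<psi>)\<^sup>2 = (norm \<eta>)\<^sup>2"
  proof -
    have "inner \<psi> (E b \<eta> - E a \<eta>) = inner (E b \<psi>) \<eta> - inner (E a \<psi>) \<eta>"
      using \<psi>(1) \<eta> by (simp add: inner_diff_right E_sym)
    also have "E b \<eta> - E a \<eta> = \<psi>"
      by (simp add: \<psi>_def)
    finally show ?thesis
      using \<psi> \<eta>\<psi> by (simp add: inner_commute power2_norm_eq_inner)
  qed
  have "inner \<eta> (t *\<^sub>R \<psi>) \<le> \<epsilon> * ((norm p)\<^sup>2 + (norm (t *\<^sub>R \<psi>))\<^sup>2) / 2" for t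
  proof -
    define \<zeta> where "\<zeta> = t *\<^sub>R \<psi>"
    have \<zeta>: "\<zeta> \<in> H" "E a \<zeta> = 0" "E b \<zeta> = \<zeta>"
      using \<psi> by (auto simp: \<zeta>_def E_scale)
    have "inner \<eta> \<zeta> = inner (L p) \<zeta> - c * inner p \<zeta>"
      by (simp add: \<eta>_def inner_diff_left)
    also have "\<dots> = (((\<integral>s. s \<partial>spectral_measure E (p + \<zeta>)) - c * (norm (p + \<zeta>))\<^sup>2) -
        ((\<integral>s. s \<partial>spectral_measure E (p - \<zeta>)) - c * (norm (p - \<zeta>))\<^sup>2)) / 4"
      using inner_L[OF pD jump_in_D[OF \<zeta>]] unfolding power2_norm_eq_inner
      by (simp add: inner_commute algebra_simps)
    also have "\<dots> \<le> (\<epsilon> * (norm (p + \<zeta>))\<^sup>2 + \<epsilon> * (norm (p - \<zeta>))\<^sup>2) / 4"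
      using integral_shift_jump[of "p + \<zeta>" a b c \<epsilon>] integral_shift_jump[of "p - \<zeta>" a b c \<epsilon>] p \<zeta> c
      by (simp add: E_add E_diff abs_le_iff)
    also have "\<dots> = \<epsilon> * ((norm p)\<^sup>2 + (norm \<zeta>)\<^sup>2) / 2"
      unfolding power2_norm_eq_inner by (simp add: algebra_simps inner_commute)
    finally show ?thesis
      by (simp add: \<zeta>_def)
  qed
  \<comment> \<open>With the scale \<open>1 / \<epsilon>\<close> half of the left-hand side
    reappears on the right and can be absorbed, which gives the constant \<open>\<epsilon>\<close>
    exactly.\<close>
  from this[of "1 / \<epsilon>"] have "(norm \<eta>)\<^sup>2 / \<epsilon> \<le> \<epsilon> * ((norm p)\<^sup>2 + (norm \<eta>)\<^sup>2 / \<epsilon>\<^sup>2) / 2"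
    by (simp add: \<eta>\<psi> power_mult_distrib power_divide norm_\<psi>)
  then have "(norm \<eta>)\<^sup>2 \<le> (\<epsilon> * norm p)\<^sup>2"
    using \<open>0 < \<epsilon>\<close> by (simp add: field_simps power2_eq_square)
  then have "norm \<eta> \<le> \<epsilon> * norm p"
    by (rule power2_le_imp_le) (use \<open>0 < \<epsilon>\<close> in simp)
  then show ?thesis
    by (simp only: \<eta>_def)
qed

text \<open>A nonzero increment of \<open>E\<close> inside a tiny window around \<open>c\<close>
  would be an approximate eigenvector for \<open>c\<close>, contradicting the resolvent
  bound.\<close>

lemma E_const_near_resolvent:
  assumes "c \<notin> spectrum H D L"
  shows "\<exists>\<delta>>0. \<forall>\<phi>\<in>H. \<forall>a\<in>{c-\<delta><..<c+\<delta>}. \<forall>b\<in>{c-\<delta><..<c+\<delta>}. E a \<phi> = E b \<phi>"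
proof -
  obtain C where C: "\<And>\<phi>. \<phi> \<in> D \<Longrightarrow> norm \<phi> \<le> C * norm (L \<phi> - c *\<^sub>R \<phi>)"
    using assms by (auto simp: spectrum_def)
  \<comment> \<open>Half the reciprocal of a strict upper bound of the resolvent constant, so that
    the two estimates combine to \<open>norm p <= norm p / 2\<close>.\<close>
  define \<delta> where "\<delta> = 1 / (2 * (\<bar>C\<bar> + 1))"
  have "0 < \<delta>" by (simp add: \<delta>_def)
  have le: "E a \<phi> = E b \<phi>" if "\<phi> \<in> H" "c - \<delta> < a" "a < b" "b < c + \<delta>" for \<phi> a b
  proof -
    define p where "p = E b \<phi> - E a \<phi>"
    have p: "p \<in> H" "E a p = 0" "E b p = p"
      using that by (auto simp: p_def E_jump)
    have "norm (L p - c *\<^sub>R p) \<le> \<delta> * norm p"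
      using that \<open>0 < \<delta>\<close> by (intro jump_estimate[OF p]) auto
    then have "C * norm (L p - c *\<^sub>R p) \<le> (\<bar>C\<bar> + 1) * (\<delta> * norm p)"
      by (intro mult_mono) auto
    also have "\<dots> = norm p / 2"
      by (simp add: \<delta>_def field_simps)
    finally have "norm p \<le> norm p / 2"
      using C[OF jump_in_D[OF p]] by linarith
    then show ?thesis
      by (simp add: p_def)
  qed
  have "E a \<phi> = E b \<phi>" if "\<phi> \<in> H" "a \<in> {c-\<delta><..<c+\<delta>}" "b \<in> {c-\<delta><..<c+\<delta>}" for \<phi> a b
    using le[of \<phi> a b] le[of \<phi> b a] that by (cases a b rule: linorder_cases) auto
  with \<open>0 < \<delta>\<close> show ?thesis by blast
qed

lemma E_const_on_interval:
  assumes "x < y" "{x<..<y} \<inter> spectrum H D L = {}" "\<phi> \<in> H" "a \<in> {x<..<y}" "b \<in> {x<..<y}"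
  shows "E a \<phi> = E b \<phi>"
proof (rule connected_local_const[of "{x<..<y}" a b "\<lambda>t. E t \<phi>"])
  show "\<forall>c\<in>{x<..<y}. eventually (\<lambda>t. E c \<phi> = E t \<phi>) (at c within {x<..<y})"
  proof
    fix c assume "c \<in> {x<..<y}"
    then obtain \<delta> where "0 < \<delta>" and \<delta>: "\<forall>a\<in>{c-\<delta><..<c+\<delta>}. \<forall>b\<in>{c-\<delta><..<c+\<delta>}. E a \<phi> = E b \<phi>"
      using E_const_near_resolvent[of c] assms(2,3) by blast
    have "E c \<phi> = E t \<phi>" if "dist t c < \<delta>" for t
      using \<delta>[rule_format, of c t] that \<open>0 < \<delta>\<close> by (auto simp: dist_real_def abs_less_iff)
    then show "eventually (\<lambda>t. E c \<phi> = E t \<phi>) (at c within {x<..<y})"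
      using \<open>0 < \<delta>\<close> by (auto simp: eventually_at)
  qed
qed (use assms in auto)

text \<open>Below the spectrum the family is constant, and its limit at minus infinity is 0. This
  supplies the \<open>gap\<close> assumption.\<close>

lemma E_below_spectrum:
  assumes "\<And>s. s \<in> spectrum H D L \<Longrightarrow> m \<le> s" "t < m" "\<phi> \<in> H"
  shows "E t \<phi> = 0"
proof -
  have "E s \<phi> = E t \<phi>" if "s < t" for s
  proof (rule E_const_on_interval[of "s - 1" m])
    show "{s - 1<..<m} \<inter> spectrum H D L = {}"
      using assms(1) by (meson disjoint_iff greaterThanLessThan_iff not_le)
  qed (use that assms in auto)
  then have "eventually (\<lambda>s. E s \<phi> = E t \<phi>) at_bot"
    by (auto simp: eventually_at_bot_dense)
  then show ?thesis
    using tendsto_unique[OF _ E_at_bot[OF assms(3)]] tendsto_eventually by force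
qed

text \<open>An eigenvector described by \<open>E\<close>: its whole spectral mass sits at
  \<open>s\<close>. In this form the actions of both \<open>L\<close> and \<open>heat\<close> can be
  computed. The zero vector is allowed, so increments of \<open>E\<close> need no case
  distinction.\<close>

definition eigenjump :: "real \<Rightarrow> 'h \<Rightarrow> bool" where
  "eigenjump s p \<longleftrightarrow> p \<in> H \<and> (\<forall>t. E t p = (if t < s then 0 else p))"

lemma eigenjump_in_D: "eigenjump s p \<Longrightarrow> p \<in> D"
  by (rule jump_in_D[of p "s - 1" s]) (auto simp: eigenjump_def)

text \<open>The window from \<open>s - \<epsilon>\<close> to \<open>s\<close> contains the jump for
  every positive \<open>\<epsilon>\<close>, so the residual is arbitrarily small.\<close>

lemma eigenjump_eigenvector:
  assumes "eigenjump s p"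
  shows "L p = s *\<^sub>R p"
proof -
  have "norm (L p - s *\<^sub>R p) \<le> \<epsilon> * norm p" if "0 < \<epsilon>" for \<epsilon>
    using assms that by (intro jump_estimate[of p "s - \<epsilon>" s]) (auto simp: eigenjump_def)
  then have "norm (L p - s *\<^sub>R p) \<le> e" if "0 < e" for e
  proof (cases "p = 0")
    case False
    then show ?thesis
      using \<open>\<And>\<epsilon>. 0 < \<epsilon> \<Longrightarrow> norm (L p - s *\<^sub>R p) \<le> \<epsilon> * norm p\<close>[of "e / norm p"] that by simp
  qed (use \<open>\<And>\<epsilon>. 0 < \<epsilon> \<Longrightarrow> norm (L p - s *\<^sub>R p) \<le> \<epsilon> * norm p\<close>[of 1] that in auto)
  then have "norm (L p - s *\<^sub>R p) \<le> 0"
    by (rule field_le_epsilon[of _ 0, simplified])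
  then show ?thesis by simp
qed

text \<open>Totality of the eigenvectors: orthogonality removes every jump of \<open>E t x\<close>,
  and since the spectrum is isolated points the curve is then locally constant on the whole line.
  Its limits 0 and \<open>x\<close> at the two ends must coincide.\<close>

lemma orthogonal_to_eigenjumps:
  assumes discrete: "discrete_spectrum H D L" and x: "x \<in> H"
    and orth: "\<And>s p. eigenjump s p \<Longrightarrow> inner x p = 0"
  shows "x = 0"
proof -
  have "eventually (\<lambda>t. E s x = E t x) (at s)" for s
  proof (cases "s \<in> spectrum H D L")
    case False
    then obtain \<delta> where "0 < \<delta>" and \<delta>: "\<forall>a\<in>{s-\<delta><..<s+\<delta>}. \<forall>b\<in>{s-\<delta><..<s+\<delta>}. E a x = E b x"
      using E_const_near_resolvent x by blast
    have "E s x = E t x" if "dist t s < \<delta>" for t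
      using \<delta>[rule_format, of s t] that \<open>0 < \<delta>\<close> by (auto simp: dist_real_def abs_less_iff)
    then show ?thesis
      using \<open>0 < \<delta>\<close> by (auto simp: eventually_at)
  next
    case True
    then obtain U where "open U" "U \<inter> spectrum H D L = {s}"
      using discrete by (auto simp: discrete_spectrum_def isolated_in_def)
    then obtain \<delta> where "0 < \<delta>" "ball s \<delta> \<subseteq> U"
      by (metis IntD1 insertI1 open_contains_ball)
    then have \<delta>: "t = s" if "s - \<delta> < t" "t < s + \<delta>" "t \<in> spectrum H D L" for t
      using \<open>U \<inter> spectrum H D L = {s}\<close> that by (auto simp: ball_eq_greaterThanLessThan)
    \<comment> \<open>To the right of an isolated spectral point no jump can occur, by
      right-continuity; only the left-hand side needs orthogonality.\<close>
    have right: "E s x = E t x" if t: "s < t" "t < s + \<delta>" for t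
    proof -
      have "E u x = E t x" if "s < u" "u < s + \<delta>" for u
      proof (rule E_const_on_interval[of s "s + \<delta>"])
        show "{s<..<s + \<delta>} \<inter> spectrum H D L = {}"
          using \<delta> \<open>0 < \<delta>\<close> by force
      qed (use that t x in auto)
      then have "eventually (\<lambda>u. E u x = E t x) (at_right s)"
        using \<open>0 < \<delta>\<close> by (auto simp: eventually_at_right[of s "s + \<delta>"] intro!: exI[of _ "s + \<delta>"])
      then show ?thesis
        using tendsto_unique[OF _ E_right_cont[OF x]] tendsto_eventually by force
    qed
    have left_const: "E u x = E t x" if "s - \<delta> < t" "t < s" "s - \<delta> < u" "u < s" for t u
    proof (rule E_const_on_interval[of "s - \<delta>" s])
      show "{s - \<delta><..<s} \<inter> spectrum H D L = {}"
        using \<delta> \<open>0 < \<delta>\<close> by force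
    qed (use that x in auto)
    have left: "E s x = E t x" if t: "s - \<delta> < t" "t < s" for t
    proof -
      \<comment> \<open>The left-hand increment is an eigenjump at \<open>s\<close>, and its inner
        product with \<open>x\<close> equals its own squared norm, so orthogonality forces it to
        vanish.\<close>
      define p where "p = E s x - E t x"
      have "E u p = (if u < s then 0 else p)" for u
        using left_const[OF t, of u] t x by (auto simp: p_def E_jump)
      then have "eigenjump s p"
        using x by (simp add: eigenjump_def p_def)
      moreover have "inner x p = (norm p)\<^sup>2"
      proof -
        have "inner p p = inner (E s p - E t p) x"
          using x by (simp add: p_def inner_diff_left inner_diff_right E_sym)
        also have "\<dots> = inner x p"
          using \<open>eigenjump s p\<close> t by (simp add: eigenjump_def inner_commute)
        finally show ?thesis
          by (simp add: power2_norm_eq_inner)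
      qed
      ultimately show ?thesis
        using orth[of s p] by (simp add: p_def)
    qed
    have "E s x = E t x" if "dist t s < \<delta>" for t
      using left[of t] right[of t] that by (cases t s rule: linorder_cases) (auto simp: dist_real_def)
    then show ?thesis
      using \<open>0 < \<delta>\<close> by (auto simp: eventually_at)
  qed
  then have const: "E s x = E t x" for s t
    by (intro connected_local_const[of UNIV s t "\<lambda>t. E t x"]) auto
  have "((\<lambda>t. E t x) \<longlongrightarrow> E 0 x) at_bot" "((\<lambda>t. E t x) \<longlongrightarrow> E 0 x) at_top"
    using const[of _ 0] by (auto intro!: tendsto_eventually always_eventually)
  then have "E 0 x = 0" "E 0 x = x"
    using tendsto_unique[OF _ _ E_at_bot[OF x]] tendsto_unique[OF _ _ E_at_top[OF x]] by force+
  then show ?thesis by simp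
qed

end

section \<open>Test functions and a weak differential equation\<close>

lemma frechet_derivative_real_1:
  fixes f :: "real \<Rightarrow> real"
  assumes "(f has_real_derivative f') (at x)"
  shows "frechet_derivative f (at x) 1 = f'"
proof -
  have "(*) f' = frechet_derivative f (at x)"
    by (rule frechet_derivative_at) (use assms in \<open>simp add: has_field_derivative_def\<close>)
  from fun_cong[OF this, of 1] show ?thesis by simp
qed

text \<open>On the real line the only basis vector is 1, so the recursion over directional
  derivatives becomes one over an ordinary derivative, suited to induction.\<close>

lemma continuously_diff_Suc_real_iff:
  fixes f :: "real \<Rightarrow> real"
  shows "continuously_diff (Suc k) f \<longleftrightarrow>
    (\<exists>f'. (\<forall>x. (f has_real_derivative f' x) (at x)) \<and> continuously_diff k f')"
proof
  assume f: "continuously_diff (Suc k) f"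
  define f' where "f' x = frechet_derivative f (at x) 1" for x
  have "(f has_real_derivative f' x) (at x)" for x
  proof -
    obtain D where D: "(f has_real_derivative D) (at x)"
      using f by (auto simp: real_differentiable_def)
    with frechet_derivative_real_1[OF D] show ?thesis
      by (simp add: f'_def)
  qed
  moreover have "continuously_diff k f'"
    using f unfolding f'_def by simp
  ultimately show "\<exists>f'. (\<forall>x. (f has_real_derivative f' x) (at x)) \<and> continuously_diff k f'" by blast
next
  assume "\<exists>f'. (\<forall>x. (f has_real_derivative f' x) (at x)) \<and> continuously_diff k f'"
  then obtain f' where f': "\<And>x. (f has_real_derivative f' x) (at x)" "continuously_diff k f'"
    by blast
  then have "(\<lambda>x. frechet_derivative f (at x) 1) = f'"
    using frechet_derivative_real_1 by blast
  with f' show "continuously_diff (Suc k) f"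
    by (auto simp: real_differentiable_def)
qed

lemma continuously_diff_SucI:
  fixes f :: "real \<Rightarrow> real"
  assumes "\<And>x. (f has_real_derivative f' x) (at x)" "continuously_diff k f'"
  shows "continuously_diff (Suc k) f"
  unfolding continuously_diff_Suc_real_iff using assms by blast

declare continuously_diff.simps(2) [simp del]

lemma continuously_diff_Suc_lower:
  fixes f :: "real \<Rightarrow> real"
  shows "continuously_diff (Suc k) f \<Longrightarrow> continuously_diff k f"
proof (induction k arbitrary: f)
  case 0
  then obtain f' where "\<And>x. (f has_real_derivative f' x) (at x)"
    using continuously_diff_Suc_real_iff[of 0 f] by blast
  then have "continuous_on UNIV f"
    using DERIV_isCont continuous_at_imp_continuous_on by blast
  then show ?case by simp
next
  case (Suc k)
  then obtain f' where "\<And>x. (f has_real_derivative f' x) (at x)" "continuously_diff (Suc k) f'"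
    using continuously_diff_Suc_real_iff[of "Suc k" f] by blast
  then show ?case
    using Suc.IH continuously_diff_SucI by blast
qed

section \<open>Closure properties of smooth real functions\<close>

lemma continuously_diff_const: "continuously_diff k (\<lambda>x::real. c::real)"
proof (induction k arbitrary: c)
  case (Suc k)
  show ?case
    by (rule continuously_diff_SucI[OF _ Suc[of 0]]) simp
qed simp

lemma continuously_diff_add:
  fixes f g :: "real \<Rightarrow> real"
  shows "continuously_diff k f \<Longrightarrow> continuously_diff k g \<Longrightarrow> continuously_diff k (\<lambda>x. f x + g x)"
proof (induction k arbitrary: f g)
  case 0
  then show ?case by (simp add: continuous_on_add continuous_on_mult)
next
  case (Suc k)
  then obtain f' g' where fg: "\<And>x. (f has_real_derivative f' x) (at x)" "continuously_diff k f'"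
    "\<And>x. (g has_real_derivative g' x) (at x)" "continuously_diff k g'"
    unfolding continuously_diff_Suc_real_iff by blast
  show ?case
    by (rule continuously_diff_SucI[OF DERIV_add[OF fg(1,3)] Suc.IH[OF fg(2,4)]])
qed

lemma continuously_diff_mult:
  fixes f g :: "real \<Rightarrow> real"
  shows "continuously_diff k f \<Longrightarrow> continuously_diff k g \<Longrightarrow> continuously_diff k (\<lambda>x. f x * g x)"
proof (induction k arbitrary: f g)
  case 0
  then show ?case by (simp add: continuous_on_add continuous_on_mult)
next
  case (Suc k)
  then obtain f' g' where fg: "\<And>x. (f has_real_derivative f' x) (at x)" "continuously_diff k f'"
    "\<And>x. (g has_real_derivative g' x) (at x)" "continuously_diff k g'"
    unfolding continuously_diff_Suc_real_iff by blast
  have "continuously_diff k f" "continuously_diff k g"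
    using Suc.prems continuously_diff_Suc_lower by blast+
  with fg have "continuously_diff k (\<lambda>x. f' x * g x + g' x * f x)"
    by (intro continuously_diff_add Suc.IH)
  then show ?case
    by (rule continuously_diff_SucI[OF DERIV_mult[OF fg(1,3)]])
qed

lemma continuously_diff_compose:
  fixes f g :: "real \<Rightarrow> real"
  shows "continuously_diff k f \<Longrightarrow> continuously_diff k g \<Longrightarrow> continuously_diff k (\<lambda>x. f (g x))"
proof (induction k arbitrary: f g)
  case 0
  then show ?case using continuous_on_compose2[of UNIV f UNIV g] by simp
next
  case (Suc k)
  then obtain f' g' where fg: "\<And>x. (f has_real_derivative f' x) (at x)" "continuously_diff k f'"
    "\<And>x. (g has_real_derivative g' x) (at x)" "continuously_diff k g'"
    unfolding continuously_diff_Suc_real_iff by blast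
  have "continuously_diff k g"
    using Suc.prems(2) by (rule continuously_diff_Suc_lower)
  from continuously_diff_mult[OF Suc.IH[OF fg(2) this] fg(4)]
  have "continuously_diff k (\<lambda>x. f' (g x) * g' x)" .
  then show ?case
    by (rule continuously_diff_SucI[OF DERIV_chain2[OF fg(1,3)]])
qed

lemma continuously_diff_linear: "continuously_diff k (\<lambda>x::real. c * x + d)"
proof (cases k)
  case 0
  have "continuous_on UNIV (\<lambda>x::real. c * x + d)"
    by (intro continuous_intros)
  with 0 show ?thesis by simp
next
  case (Suc j)
  have "((\<lambda>x. c * x + d) has_real_derivative c) (at x)" for x
    using DERIV_add[OF DERIV_cmult[OF DERIV_ident, of c] DERIV_const[of d]] by simp
  then show ?thesis
    unfolding Suc by (rule continuously_diff_SucI) (rule continuously_diff_const)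
qed

lemma continuously_diff_exp: "continuously_diff k (exp :: real \<Rightarrow> real)"
proof (induction k)
  case 0
  have "continuous_on UNIV (exp :: real \<Rightarrow> real)"
    by (intro continuous_intros)
  then show ?case by simp
next
  case (Suc k)
  then show ?case
    by (rule continuously_diff_SucI[OF DERIV_exp])
qed

text \<open>The factor \<open>(1/x)^n\<close> makes the family closed under differentiation up to
  linear combinations, so one induction on the order of differentiability covers all
  \<open>n\<close> at once.\<close>

definition flat :: "nat \<Rightarrow> real \<Rightarrow> real" where
  "flat n x = (if 0 < x then (1 / x) ^ n * exp (- (1 / x)) else 0)"

lemma flat_nonneg: "0 \<le> flat n x"
  by (simp add: flat_def)

lemma flat_eq_0: "x \<le> 0 \<Longrightarrow> flat n x = 0"
  by (simp add: flat_def)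

lemma flat_tendsto_0: "(flat n \<longlongrightarrow> 0) (at 0)"
proof (rule filterlim_split_at)
  show "(flat n \<longlongrightarrow> 0) (at_left 0)"
    by (rule tendsto_eventually) (auto simp: flat_def eventually_at_filter)
  have "((\<lambda>x. (inverse x) ^ n / exp (inverse x)) \<longlongrightarrow> 0) (at_right (0::real))"
    by (rule filterlim_compose[OF tendsto_power_div_exp_0 filterlim_inverse_at_top_right])
  then show "(flat n \<longlongrightarrow> 0) (at_right 0)"
    by (rule Lim_transform_eventually)
      (auto simp: flat_def eventually_at_filter exp_minus divide_inverse)
qed

lemma flat_has_derivative:
  "(flat n has_real_derivative (flat (n + 2) x - real n * flat (n + 1) x)) (at x)"
proof (cases x "0::real" rule: linorder_cases)
  case less
  have "((\<lambda>x. 0) has_real_derivative 0) (at x)" by simp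
  then have "(flat n has_real_derivative 0) (at x)"
    by (rule has_field_derivative_transform_within_open[of _ _ _ "{..<0}"]) (use less in \<open>auto simp: flat_def\<close>)
  then show ?thesis
    using less by (simp add: flat_def)
next
  case equal
  \<comment> \<open>The difference quotient of \<open>flat n\<close> at 0 is
    \<open>flat (n + 1)\<close>, which tends to 0.\<close>
  have "((\<lambda>y. (flat n y - flat n 0) / (y - 0)) \<longlongrightarrow> 0) (at 0)"
    using flat_tendsto_0[of "n + 1"]
    by (rule Lim_transform_eventually) (auto simp: flat_def eventually_at_filter)
  then show ?thesis
    using equal by (simp add: has_field_derivative_iff flat_def)
next
  case greater
  have "((\<lambda>x. (1 / x) ^ n * exp (- (1 / x))) has_real_derivative
      (1 / x) ^ (n + 2) * exp (- (1 / x)) - real n * ((1 / x) ^ (n + 1) * exp (- (1 / x)))) (at x)"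
  proof -
    have inv: "((\<lambda>x. 1 / x) has_real_derivative - ((1 / x)\<^sup>2)) (at x)"
      using greater by (auto intro!: derivative_eq_intros simp: power2_eq_square)
    show ?thesis
      by (rule DERIV_cong[OF DERIV_mult[OF DERIV_power[OF inv, of n] DERIV_fun_exp[OF DERIV_minus[OF inv]]]])
        (cases n; simp add: algebra_simps power2_eq_square)
  qed
  then have "(flat n has_real_derivative
      (1 / x) ^ (n + 2) * exp (- (1 / x)) - real n * ((1 / x) ^ (n + 1) * exp (- (1 / x)))) (at x)"
    by (rule has_field_derivative_transform_within_open[of _ _ _ "{0<..}"]) (use greater in \<open>auto simp: flat_def\<close>)
  then show ?thesis
    using greater by (simp add: flat_def)
qed

lemma continuously_diff_flat: "continuously_diff k (flat n)"
proof (induction k arbitrary: n)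
  case 0
  show ?case
    by (auto intro!: continuous_at_imp_continuous_on DERIV_isCont[OF flat_has_derivative])
next
  case (Suc k)
  have "continuously_diff k (\<lambda>x. flat (n + 2) x + (- real n) * flat (n + 1) x)"
    by (intro continuously_diff_add continuously_diff_mult continuously_diff_const Suc)
  then show ?case
    by (intro continuously_diff_SucI[OF flat_has_derivative]) simp
qed

text \<open>A smooth monotone step, built as \<open>e (e 1 - e (1 - x))\<close> with \<open>e x = exp (-1/x)\<close> for \<open>x > 0\<close>:
  the inner argument is nonpositive for \<open>x \<le> 0\<close> and constant for \<open>x \<ge> 1\<close>.\<close>

definition unit_step :: "real \<Rightarrow> real" where
  "unit_step x = flat 0 (exp (-1) - flat 0 (1 - x)) / flat 0 (exp (-1))"

text \<open>The chain-rule derivative of \<open>unit_step\<close>, written out with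
  \<open>flat 2\<close>, the derivative of \<open>flat 0\<close>.\<close>

definition unit_bump :: "real \<Rightarrow> real" where
  "unit_bump x = flat 2 (exp (-1) - flat 0 (1 - x)) * flat 2 (1 - x) / flat 0 (exp (-1))"

lemma unit_step_inner_le_0:
  assumes "x \<le> 0"
  shows "exp (-1) - flat 0 (1 - x) \<le> 0"
proof -
  have "-1 \<le> - (1 / (1 - x))"
    using assms by (simp add: field_simps)
  then show ?thesis
    using assms by (simp add: flat_def)
qed

lemma unit_step_eq_0: "x \<le> 0 \<Longrightarrow> unit_step x = 0"
  unfolding unit_step_def by (simp only: flat_eq_0[OF unit_step_inner_le_0] div_0)

lemma unit_step_eq_1: "1 \<le> x \<Longrightarrow> unit_step x = 1"
  unfolding unit_step_def by (simp add: flat_eq_0) (simp add: flat_def)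

lemma unit_bump_nonneg: "0 \<le> unit_bump x"
  by (simp add: unit_bump_def flat_nonneg)

lemma unit_bump_eq_0: "x \<le> 0 \<or> 1 \<le> x \<Longrightarrow> unit_bump x = 0"
  unfolding unit_bump_def using flat_eq_0[OF unit_step_inner_le_0[of x], of 2] flat_eq_0[of "1 - x" 2]
  by (elim disjE) simp_all

lemma unit_step_has_derivative: "(unit_step has_real_derivative unit_bump x) (at x)"
proof -
  have d: "(flat 0 has_real_derivative flat 2 y) (at y)" for y
    using flat_has_derivative[of 0 y] by (simp add: numeral_2_eq_2)
  have "((\<lambda>x. flat 0 (1 - x)) has_real_derivative flat 2 (1 - x) * (-1)) (at x)"
    by (rule DERIV_chain2[OF d]) (auto intro!: derivative_eq_intros)
  then have "((\<lambda>x. exp (-1) - flat 0 (1 - x)) has_real_derivative flat 2 (1 - x)) (at x)"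
    by (auto intro!: derivative_eq_intros)
  from DERIV_cdivide[OF DERIV_chain2[OF d this], of "flat 0 (exp (-1))"] show ?thesis
    unfolding unit_step_def unit_bump_def .
qed

lemma continuously_diff_unit_step: "continuously_diff k unit_step"
proof -
  have "continuously_diff k (\<lambda>x. flat 0 (-1 * flat 0 (-1 * x + 1) + exp (-1)) * (1 / flat 0 (exp (-1))))"
    by (rule continuously_diff_mult[OF continuously_diff_compose[OF continuously_diff_flat
          continuously_diff_compose[OF continuously_diff_linear
            continuously_diff_compose[OF continuously_diff_flat continuously_diff_linear]]]
        continuously_diff_const])
  then show ?thesis
    by (simp add: unit_step_def[abs_def] algebra_simps)
qed

section \<open>Steps and unit-mass bumps on an arbitrary interval\<close>

definition step :: "real \<Rightarrow> real \<Rightarrow> real \<Rightarrow> real" where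
  "step a h t = unit_step ((t - a) / h)"

definition bump :: "real \<Rightarrow> real \<Rightarrow> real \<Rightarrow> real" where
  "bump a h t = unit_bump ((t - a) / h) / h"

lemma step_has_derivative:
  assumes "0 < h"
  shows "(step a h has_real_derivative bump a h t) (at t)"
proof -
  have "((\<lambda>t. (t - a) / h) has_real_derivative 1 / h) (at t)"
    using assms by (auto intro!: derivative_eq_intros)
  from DERIV_chain2[OF unit_step_has_derivative this] show ?thesis
    by (simp add: step_def[abs_def] bump_def)
qed

lemma step_eq_0: "0 < h \<Longrightarrow> t \<le> a \<Longrightarrow> step a h t = 0"
  by (simp add: step_def unit_step_eq_0 divide_nonpos_pos)

lemma step_eq_1: "0 < h \<Longrightarrow> a + h \<le> t \<Longrightarrow> step a h t = 1"
  by (simp add: step_def unit_step_eq_1 le_divide_eq)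

lemma bump_nonneg: "0 < h \<Longrightarrow> 0 \<le> bump a h t"
  by (simp add: bump_def unit_bump_nonneg)

lemma bump_eq_0:
  assumes "0 < h" "t \<notin> {a..a+h}"
  shows "bump a h t = 0"
proof -
  have "(t - a) / h \<le> 0 \<or> 1 \<le> (t - a) / h"
    using assms by (auto simp: divide_le_0_iff le_divide_eq)
  then show ?thesis
    by (simp add: bump_def unit_bump_eq_0)
qed

lemma continuously_diff_step: "continuously_diff k (step a h)"
proof -
  have "continuously_diff k (\<lambda>t. unit_step ((1 / h) * t + (- a / h)))"
    by (rule continuously_diff_compose[OF continuously_diff_unit_step continuously_diff_linear])
  then show ?thesis
    by (simp add: step_def[abs_def] diff_divide_distrib)
qed

lemma continuous_on_bump:
  assumes "0 < h"
  shows "continuous_on S (bump a h)"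
proof -
  obtain f' where f': "\<And>x. (step a h has_real_derivative f' x) (at x)" "continuously_diff 0 f'"
    using continuously_diff_step[of "Suc 0" a h] unfolding continuously_diff_Suc_real_iff by blast
  have "f' = bump a h"
    using DERIV_unique[OF f'(1) step_has_derivative[OF assms]] by blast
  then show ?thesis
    using f'(2) by (auto intro: continuous_on_subset)
qed

lemma has_integral_bump:
  assumes "0 < h" "x \<le> a" "a + h \<le> y"
  shows "(bump a h has_integral 1) {x..y}"
proof -
  have "(bump a h has_integral (step a h y - step a h x)) {x..y}"
    using assms step_has_derivative[OF assms(1)]
    by (intro fundamental_theorem_of_calculus)
      (auto simp: has_real_derivative_iff_has_vector_derivative[symmetric] intro: has_field_derivative_at_within)
  then show ?thesis
    using assms by (simp add: step_eq_0 step_eq_1)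
qed

text \<open>Being non-negative with integral 1, the bump averages \<open>z\<close> over a short
  interval. Its mass is known because it is the derivative of a step from 0 to 1.\<close>

lemma integral_bump_approx:
  assumes "0 < h" "x \<le> a" "a + h \<le> y" "continuous_on {x..y} z"
    and close: "\<And>t. t \<in> {a..a+h} \<Longrightarrow> \<bar>z t - c\<bar> \<le> e"
  shows "\<bar>integral {x..y} (\<lambda>t. z t * bump a h t) - c\<bar> \<le> e"
proof -
  have int_b: "integral {x..y} (bump a h) = 1" "bump a h integrable_on {x..y}"
    using has_integral_bump[OF assms(1-3)] by (auto simp: integral_unique)
  have int: "(\<lambda>t. z t * bump a h t) integrable_on {x..y}" "(\<lambda>t. c * bump a h t) integrable_on {x..y}"
    "(\<lambda>t. (z t - c) * bump a h t) integrable_on {x..y}"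
    using assms(1,4) by (auto intro!: integrable_continuous_real continuous_intros continuous_on_bump)
  have "integral {x..y} (\<lambda>t. z t * bump a h t) - c =
      integral {x..y} (\<lambda>t. z t * bump a h t) - integral {x..y} (\<lambda>t. c * bump a h t)"
    using int_b by simp
  also have "\<dots> = integral {x..y} (\<lambda>t. (z t - c) * bump a h t)"
    using Henstock_Kurzweil_Integration.integral_diff[OF int(1,2)] by (simp only: left_diff_distrib)
  also have "norm \<dots> \<le> integral {x..y} (\<lambda>t. e * bump a h t)"
  proof (rule integral_norm_bound_integral[OF int(3)])
    show "(\<lambda>t. e * bump a h t) integrable_on {x..y}"
      using assms(1) by (intro integrable_continuous_real continuous_intros continuous_on_bump)
    show "norm ((z t - c) * bump a h t) \<le> e * bump a h t" for t
    proof (cases "t \<in> {a..a+h}")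
      case True
      then show ?thesis
        using close[OF True] bump_nonneg[OF assms(1), of a t] by (simp add: abs_mult mult_right_mono)
    qed (simp add: bump_eq_0 assms)
  qed
  finally show ?thesis
    using int_b by simp
qed

section \<open>Weak differential equations on a bounded interval\<close>

lemma integrable_lebesgue_on_open_interval:
  fixes g :: "real \<Rightarrow> real"
  assumes "continuous_on {a..b} g"
  shows "integrable (lebesgue_on {a<..<b}) g"
proof -
  have "set_integrable lebesgue {a..b} g"
    using continuous_imp_integrable_real[OF assms]
    by (simp add: set_integrable_def integrable_restrict_space)
  then have "set_integrable lebesgue {a<..<b} g"
    by (rule set_integrable_subset) auto
  then show ?thesis
    by (simp add: set_integrable_def integrable_restrict_space)
qed

lemma integral_lebesgue_on_open_interval:
  fixes g :: "real \<Rightarrow> real"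
  assumes "continuous_on {a..b} g"
  shows "(\<integral>t. g t \<partial>lebesgue_on {a<..<b}) = integral {a..b} g"
  using lebesgue_integral_eq_integral[OF integrable_lebesgue_on_open_interval[OF assms]]
  by (simp add: integral_open_interval_real)

text \<open>The du Bois-Reymond lemma, tested with the difference of two steps near the two ends.\<close>

lemma weakly_constant_endpoints:
  fixes z :: "real \<Rightarrow> real"
  assumes "0 < T" and z: "continuous_on {0..T} z"
    and weak: "\<And>\<theta>. test_function T \<theta> \<Longrightarrow> (\<integral>t. z t * deriv \<theta> t \<partial>lebesgue_on {0<..<T}) = 0"
  shows "z T = z 0"
proof -
  have "\<bar>z T - z 0\<bar> \<le> 0 + e" if "0 < e" for e
  proof -
    obtain d0 where d0: "0 < d0" "\<And>t. t \<in> {0..T} \<Longrightarrow> dist t 0 < d0 \<Longrightarrow> dist (z t) (z 0) < e / 2"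
      using continuous_on_iff[THEN iffD1, OF z, rule_format, of 0 "e / 2"] \<open>0 < e\<close> \<open>0 < T\<close> by auto
    obtain d1 where d1: "0 < d1" "\<And>t. t \<in> {0..T} \<Longrightarrow> dist t T < d1 \<Longrightarrow> dist (z t) (z T) < e / 2"
      using continuous_on_iff[THEN iffD1, OF z, rule_format, of T "e / 2"] \<open>0 < e\<close> \<open>0 < T\<close> by auto
    \<comment> \<open>The quarter keeps both transition intervals, from \<open>h\<close> to
      \<open>2 h\<close> and from \<open>T - 2 h\<close> to \<open>T - h\<close>, within the
      continuity radii of the endpoints and free of overlap.\<close>
    define h where "h = min (min d0 d1) T / 4"
    have h: "0 < h" "2 * h < d0" "2 * h < d1" "4 * h \<le> T"
      using d0(1) d1(1) \<open>0 < T\<close> by (auto simp: h_def)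
    \<comment> \<open>A plateau function: it vanishes near both ends, while its derivative consists
      of a positive bump near 0 and a negative one near \<open>T\<close>.\<close>
    define \<theta> where "\<theta> t = step h h t + (-1) * step (T - 2 * h) h t" for t
    have d\<theta>: "(\<theta> has_real_derivative bump h h t - bump (T - 2 * h) h t) (at t)" for t
      unfolding \<theta>_def
      by (rule derivative_eq_intros step_has_derivative h refl)+ simp
    have "smooth \<theta>"
      unfolding smooth_def \<theta>_def
      by (intro allI continuously_diff_add continuously_diff_mult continuously_diff_const continuously_diff_step)
    moreover have "\<theta> t = 0" if "t \<notin> {h..T - h}" for t
      using that h by (auto simp: \<theta>_def step_eq_0 step_eq_1 not_le)
    ultimately have "test_function T \<theta>"
      unfolding test_function_def using h by (intro conjI exI[of _ h] exI[of _ "T - h"]) auto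
    from weak[OF this] have "0 = (\<integral>t. z t * (bump h h t - bump (T - 2 * h) h t) \<partial>lebesgue_on {0<..<T})"
      by (simp only: DERIV_imp_deriv[OF d\<theta>])
    also have "\<dots> = integral {0..T} (\<lambda>t. z t * (bump h h t - bump (T - 2 * h) h t))"
      using z h by (intro integral_lebesgue_on_open_interval) (auto intro!: continuous_intros continuous_on_bump)
    also have "\<dots> = integral {0..T} (\<lambda>t. z t * bump h h t) - integral {0..T} (\<lambda>t. z t * bump (T - 2 * h) h t)"
      unfolding right_diff_distrib using z h
      by (intro Henstock_Kurzweil_Integration.integral_diff integrable_continuous_real)
        (auto intro!: continuous_intros continuous_on_bump)
    finally have eq: "integral {0..T} (\<lambda>t. z t * bump h h t) = integral {0..T} (\<lambda>t. z t * bump (T - 2 * h) h t)"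
      by simp
    have "\<bar>integral {0..T} (\<lambda>t. z t * bump h h t) - z 0\<bar> \<le> e / 2"
      using h z d0(2) by (intro integral_bump_approx) (auto simp: dist_real_def intro!: less_imp_le)
    moreover have "\<bar>integral {0..T} (\<lambda>t. z t * bump (T - 2 * h) h t) - z T\<bar> \<le> e / 2"
      using h z d1(2) by (intro integral_bump_approx) (auto simp: dist_real_def intro!: less_imp_le)
    ultimately show ?thesis
      unfolding eq by linarith
  qed
  then have "\<bar>z T - z 0\<bar> \<le> 0"
    by (rule field_le_epsilon)
  then show ?thesis by simp
qed

text \<open>Integrating factor: multiplication by \<open>exp (c t)\<close> turns the equation into
  vanishing of the weak derivative, and sends test functions to test functions. No differentiability
  of \<open>y\<close> is required.\<close>

lemma weak_exponential_decay:
  fixes y :: "real \<Rightarrow> real"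
  assumes "0 < T" and y: "continuous_on {0..T} y"
    and weak: "\<And>\<theta>. test_function T \<theta> \<Longrightarrow>
      (\<integral>t. y t * deriv \<theta> t \<partial>lebesgue_on {0<..<T}) = c * (\<integral>t. y t * \<theta> t \<partial>lebesgue_on {0<..<T})"
  shows "y T = exp (- c * T) * y 0"
proof -
  have "exp (c * T) * y T = exp (c * 0) * y 0"
  proof (rule weakly_constant_endpoints[OF \<open>0 < T\<close>])
    show "continuous_on {0..T} (\<lambda>t. exp (c * t) * y t)"
      by (intro continuous_intros y)
    fix \<theta> assume \<theta>: "test_function T \<theta>"
    then have "continuously_diff (Suc 0) \<theta>"
      unfolding test_function_def smooth_def by blast
    then obtain \<theta>' where \<theta>': "\<And>t. (\<theta> has_real_derivative \<theta>' t) (at t)" "continuous_on UNIV \<theta>'"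
      unfolding continuously_diff_Suc_real_iff by auto
    have cont: "continuous_on {0..T} \<theta>" "continuous_on {0..T} \<theta>'"
      using \<theta>' by (auto intro: continuous_on_subset continuous_at_imp_continuous_on DERIV_isCont)
    \<comment> \<open>The summand 0 brings the exponent into the shape of
      \<open>continuously_diff_linear\<close>.\<close>
    define \<omega> where "\<omega> t = exp (c * t + 0) * \<theta> t" for t
    have d\<omega>: "(\<omega> has_real_derivative exp (c * t) * (\<theta>' t + c * \<theta> t)) (at t)" for t
      unfolding \<omega>_def by (rule derivative_eq_intros \<theta>'(1) refl)+ (simp add: algebra_simps)
    have "smooth \<omega>"
      using \<theta> unfolding smooth_def \<omega>_def test_function_def
      by (intro allI continuously_diff_mult continuously_diff_compose[OF continuously_diff_exp] continuously_diff_linear) auto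
    then have "test_function T \<omega>"
      using \<theta> unfolding test_function_def \<omega>_def by auto
    from weak[OF this] have "(\<integral>t. y t * (exp (c * t) * (\<theta>' t + c * \<theta> t)) \<partial>lebesgue_on {0<..<T}) =
        (\<integral>t. c * (y t * \<omega> t) \<partial>lebesgue_on {0<..<T})"
      by (simp add: DERIV_imp_deriv[OF d\<omega>])
    then have "0 = (\<integral>t. y t * (exp (c * t) * (\<theta>' t + c * \<theta> t)) \<partial>lebesgue_on {0<..<T}) -
        (\<integral>t. c * (y t * \<omega> t) \<partial>lebesgue_on {0<..<T})"
      by simp
    also have "\<dots> = (\<integral>t. y t * (exp (c * t) * (\<theta>' t + c * \<theta> t)) - c * (y t * \<omega> t) \<partial>lebesgue_on {0<..<T})"
      unfolding \<omega>_def using cont y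
      by (intro Bochner_Integration.integral_diff[symmetric] integrable_lebesgue_on_open_interval continuous_intros)
    also have "\<dots> = (\<integral>t. exp (c * t) * y t * deriv \<theta> t \<partial>lebesgue_on {0<..<T})"
      by (simp add: \<omega>_def DERIV_imp_deriv[OF \<theta>'(1)] algebra_simps)
    finally show "(\<integral>t. exp (c * t) * y t * deriv \<theta> t \<partial>lebesgue_on {0<..<T}) = 0" by simp
  qed
  then show ?thesis
    by (simp add: exp_minus field_simps)
qed

section \<open>The Mann iteration\<close>

lemma segmenting_diagonal_bounds:
  assumes "segmenting a" "1 \<le> k"
  shows "0 \<le> a k k" "a k k \<le> 1"
proof -
  have nonneg: "0 \<le> a k j" if "1 \<le> j" for j
    using assms that unfolding segmenting_def by blast
  show "0 \<le> a k k"
    using nonneg assms(2) by blast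
  have "a k k \<le> (\<Sum>j=1..k. a k j)"
    using nonneg assms(2) by (intro member_le_sum) auto
  also have "\<dots> = 1"
    using assms unfolding segmenting_def by blast
  finally show "a k k \<le> 1" .
qed

lemma mann_v_1:
  assumes "segmenting a"
  shows "mann_v x1 a F 1 = x1"
proof -
  have "(\<Sum>j=1..1. a 1 j) = 1"
    using assms unfolding segmenting_def by blast
  then show ?thesis
    using mann_x_1[of x1 a F] by (simp add: mann_v_def)
qed

text \<open>By property (iv) of a segmenting matrix, each row is the previous row scaled down with a
  new diagonal entry appended. The averages therefore obey a one-step relaxed recursion without
  memory of the earlier iterates.\<close>

lemma mann_v_Suc:
  assumes "segmenting a" "1 \<le> k"
  shows "mann_v x1 a F (k + 1) =
    (1 - a (k + 1) (k + 1)) *\<^sub>R mann_v x1 a F k + a (k + 1) (k + 1) *\<^sub>R F (mann_v x1 a F k)"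
proof -
  have "a (k + 1) j = (1 - a (k + 1) (k + 1)) * a k j" if "j \<in> {1..k}" for j
    using assms that unfolding segmenting_def by blast
  then have "(\<Sum>j=1..k. a (k + 1) j *\<^sub>R mann_x x1 a F j) =
      (1 - a (k + 1) (k + 1)) *\<^sub>R (\<Sum>j=1..k. a k j *\<^sub>R mann_x x1 a F j)"
    unfolding scaleR_sum_right by (intro sum.cong) auto
  then show ?thesis
    using mann_x_Suc[OF assms(2), of x1 a F] by (simp add: mann_v_def)
qed

context coercive_spectral_space
begin

text \<open>The error recursion as a predicate on sequences: it is linear and commutes with
  \<open>E s\<close>, so the low and high spectral parts of a solution are solutions again.\<close>

definition relaxed_heat_iteration :: "real \<Rightarrow> (nat \<Rightarrow> real) \<Rightarrow> (nat \<Rightarrow> 'a) \<Rightarrow> bool" where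
  "relaxed_heat_iteration \<gamma> d e \<longleftrightarrow> (\<forall>k. e k \<in> H \<and> e (Suc k) = e k - (\<gamma> * d k) *\<^sub>R heat (e k))"

text \<open>Expand the square, use \<open>d * d <= d\<close>, and bound the quadratic term by
  \<open>norm_heat_le\<close>; what remains of the linear term carries the factor
  \<open>2 - \<gamma> \<kappa>\<close>.\<close>

lemma heat_relaxation_decrease:
  assumes "\<phi> \<in> H" "0 \<le> \<gamma>" "0 \<le> d" "d \<le> 1"
  shows "(norm (\<phi> - (\<gamma> * d) *\<^sub>R heat \<phi>))\<^sup>2 \<le>
    (norm \<phi>)\<^sup>2 - \<gamma> * (2 - \<gamma> * heat_symbol l) * d * inner (heat \<phi>) \<phi>"
proof -
  define \<kappa> where "\<kappa> = heat_symbol l"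
  have "d * d \<le> d"
    using assms by (simp add: mult_left_le)
  have "(norm (\<phi> - (\<gamma> * d) *\<^sub>R heat \<phi>))\<^sup>2 =
      (norm \<phi>)\<^sup>2 - 2 * \<gamma> * d * inner (heat \<phi>) \<phi> + \<gamma>\<^sup>2 * (d * d) * (norm (heat \<phi>))\<^sup>2"
    unfolding power2_norm_eq_inner
    by (simp add: inner_diff_left inner_diff_right inner_commute[of \<phi> "heat \<phi>"] power2_eq_square algebra_simps)
  also have "\<dots> \<le> (norm \<phi>)\<^sup>2 - 2 * \<gamma> * d * inner (heat \<phi>) \<phi> + \<gamma>\<^sup>2 * d * (\<kappa> * inner (heat \<phi>) \<phi>)"
    using norm_heat_le[OF assms(1)] \<open>d * d \<le> d\<close> assms
    by (intro add_left_mono mult_mono) (auto simp: \<kappa>_def)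
  also have "\<dots> = (norm \<phi>)\<^sup>2 - \<gamma> * (2 - \<gamma> * \<kappa>) * d * inner (heat \<phi>) \<phi>"
    by (simp add: algebra_simps power2_eq_square)
  finally show ?thesis
    by (simp add: \<kappa>_def)
qed

context
  fixes \<gamma> :: real and d :: "nat \<Rightarrow> real"
  assumes \<gamma>: "0 < \<gamma>" "\<gamma> * heat_symbol l < 2"
    and d: "\<And>k. 0 \<le> d k" "\<And>k. d k \<le> 1"
begin

lemma relaxation_contraction:
  assumes "\<phi> \<in> H" "0 \<le> c" "c \<le> 1"
  shows "norm (\<phi> - (\<gamma> * c) *\<^sub>R heat \<phi>) \<le> norm \<phi>"
proof -
  have "0 \<le> \<gamma> * (2 - \<gamma> * heat_symbol l) * c * inner (heat \<phi>) \<phi>"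
    using assms \<gamma> heat_nonneg by simp
  then have "(norm (\<phi> - (\<gamma> * c) *\<^sub>R heat \<phi>))\<^sup>2 \<le> (norm \<phi>)\<^sup>2"
    using heat_relaxation_decrease[OF assms(1) less_imp_le[OF \<gamma>(1)] assms(2,3)] by linarith
  then show ?thesis
    by (rule power2_le_imp_le) simp
qed

lemma relaxed_heat_iteration_norm_le:
  assumes "relaxed_heat_iteration \<gamma> d e"
  shows "norm (e k) \<le> norm (e 0)"
proof (induction k)
  case (Suc k)
  have "norm (e (Suc k)) \<le> norm (e k)"
    using assms relaxation_contraction[of "e k" "d k"] d by (simp add: relaxed_heat_iteration_def)
  with Suc show ?case by simp
qed simp

lemma relaxed_heat_iteration_E:
  assumes "relaxed_heat_iteration \<gamma> d e"
  shows "relaxed_heat_iteration \<gamma> d (\<lambda>k. E s (e k))"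
  using assms by (simp add: relaxed_heat_iteration_def E_diff E_scale heat_E)

lemma relaxed_heat_iteration_diff:
  assumes "relaxed_heat_iteration \<gamma> d e" "relaxed_heat_iteration \<gamma> d e'"
  shows "relaxed_heat_iteration \<gamma> d (\<lambda>k. e k - e' k)"
  using assms by (simp add: relaxed_heat_iteration_def heat_diff algebra_simps)

text \<open>On the range of \<open>E s\<close> the decrease is a fixed proportion of the squared
  norm times \<open>d k\<close>; \<open>1 + x <= exp x\<close> collects the factors into the
  exponent as a sum.\<close>

lemma relaxed_heat_iteration_decay:
  assumes e: "relaxed_heat_iteration \<gamma> d e" and s: "0 \<le> s" "\<And>k. E s (e k) = e k"
  shows "(norm (e k))\<^sup>2 \<le> exp (- (\<gamma> * (2 - \<gamma> * heat_symbol l) * heat_symbol s) * (\<Sum>j<k. d j)) * (norm (e 0))\<^sup>2"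
proof (induction k)
  case (Suc k)
  define \<delta> where "\<delta> = \<gamma> * (2 - \<gamma> * heat_symbol l)"
  define m where "m = heat_symbol s"
  have "0 \<le> \<delta>" using \<gamma> by (simp add: \<delta>_def)
  have eH: "e k \<in> H"
    using e by (simp add: relaxed_heat_iteration_def)
  have "(norm (e (Suc k)))\<^sup>2 \<le> (norm (e k))\<^sup>2 - \<delta> * d k * inner (heat (e k)) (e k)"
    using heat_relaxation_decrease[OF eH less_imp_le[OF \<gamma>(1)] d, of k] e
    by (simp add: relaxed_heat_iteration_def \<delta>_def)
  also have "\<dots> \<le> (norm (e k))\<^sup>2 - \<delta> * d k * (m * (norm (e k))\<^sup>2)"
    using heat_lower[OF eH s(1) s(2)] \<open>0 \<le> \<delta>\<close> d
    by (intro diff_left_mono mult_left_mono) (auto simp: m_def)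
  also have "\<dots> = (1 + (- (\<delta> * m) * d k)) * (norm (e k))\<^sup>2"
    by (simp add: algebra_simps)
  also have "\<dots> \<le> exp (- (\<delta> * m) * d k) * (norm (e k))\<^sup>2"
    by (intro mult_right_mono exp_ge_add_one_self) simp
  also have "\<dots> \<le> exp (- (\<delta> * m) * d k) * (exp (- (\<delta> * m) * (\<Sum>j<k. d j)) * (norm (e 0))\<^sup>2)"
    using Suc by (intro mult_left_mono) (auto simp: \<delta>_def m_def)
  also have "\<dots> = exp (- (\<delta> * m) * (\<Sum>j<Suc k. d j)) * (norm (e 0))\<^sup>2"
    by (simp add: exp_add[symmetric] algebra_simps mult_exp_exp)
  finally show ?case
    by (simp only: \<delta>_def m_def)
qed simp

lemma relaxed_heat_iteration_tendsto_0:
  assumes e: "relaxed_heat_iteration \<gamma> d e"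
    and diverges: "filterlim (\<lambda>n. \<Sum>j<n. d j) at_top sequentially"
  shows "e \<longlonglongrightarrow> 0"
proof (rule LIMSEQ_I)
  fix \<epsilon> :: real assume "0 < \<epsilon>"
  have e0: "e 0 \<in> H"
    using e by (simp add: relaxed_heat_iteration_def)
  have "eventually (\<lambda>s. dist (E s (e 0)) (e 0) < \<epsilon> / 2) at_top"
    using E_at_top[OF e0] \<open>0 < \<epsilon>\<close> by (intro tendstoD) auto
  then have "eventually (\<lambda>s. dist (E s (e 0)) (e 0) < \<epsilon> / 2 \<and> 0 \<le> s) at_top"
    using eventually_ge_at_top[of 0] by (rule eventually_conj)
  then obtain s where s: "dist (E s (e 0)) (e 0) < \<epsilon> / 2" "0 \<le> s"
    using eventually_happens by fastforce
  define \<delta> where "\<delta> = \<gamma> * (2 - \<gamma> * heat_symbol l) * heat_symbol s"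
  have "0 < \<delta>" using \<gamma> by (simp add: \<delta>_def)
  have low: "relaxed_heat_iteration \<gamma> d (\<lambda>k. E s (e k))"
    by (rule relaxed_heat_iteration_E[OF e])
  \<comment> \<open>The high part is again an iteration and never grows, so the cut-off selected
    from \<open>e 0\<close> serves all \<open>k\<close>.\<close>
  have high: "norm (e k - E s (e k)) < \<epsilon> / 2" for k
    using relaxed_heat_iteration_norm_le[OF relaxed_heat_iteration_diff[OF e low], of k] s(1)
    by (simp add: dist_norm norm_minus_commute)
  have decay: "(norm (E s (e k)))\<^sup>2 \<le> exp (- \<delta> * (\<Sum>j<k. d j)) * (norm (E s (e 0)))\<^sup>2" for k
    unfolding \<delta>_def using e by (intro relaxed_heat_iteration_decay[OF low s(2)])
      (simp add: relaxed_heat_iteration_def E_E)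
  have "filterlim (\<lambda>k. - \<delta> * (\<Sum>j<k. d j)) at_bot sequentially"
    using \<open>0 < \<delta>\<close> by (intro filterlim_tendsto_neg_mult_at_bot[OF tendsto_const _ diverges]) simp
  then have "(\<lambda>k. exp (- \<delta> * (\<Sum>j<k. d j))) \<longlonglongrightarrow> 0"
    by (rule filterlim_compose[OF exp_at_bot])
  then have "(\<lambda>k. exp (- \<delta> * (\<Sum>j<k. d j)) * (norm (E s (e 0)))\<^sup>2) \<longlonglongrightarrow> 0"
    by (rule tendsto_mult_left_zero)
  then have "eventually (\<lambda>k. exp (- \<delta> * (\<Sum>j<k. d j)) * (norm (E s (e 0)))\<^sup>2 < (\<epsilon> / 2)\<^sup>2) sequentially"
    using \<open>0 < \<epsilon>\<close> by (intro order_tendstoD) auto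
  then obtain N where N: "\<And>k. N \<le> k \<Longrightarrow> exp (- \<delta> * (\<Sum>j<k. d j)) * (norm (E s (e 0)))\<^sup>2 < (\<epsilon> / 2)\<^sup>2"
    by (auto simp: eventually_sequentially)
  have "norm (e k - 0) < \<epsilon>" if "N \<le> k" for k
  proof -
    have "(norm (E s (e k)))\<^sup>2 < (\<epsilon> / 2)\<^sup>2"
      using decay[of k] N[OF that] by linarith
    then have "norm (E s (e k)) < \<epsilon> / 2"
      by (rule power2_less_imp_less) (use \<open>0 < \<epsilon>\<close> in simp)
    then show ?thesis
      using high[of k] norm_triangle_ineq[of "e k - E s (e k)" "E s (e k)"] by simp
  qed
  then show "\<exists>N. \<forall>k\<ge>N. norm (e k - 0) < \<epsilon>" by blast
qed

end

lemma mann_iteration_converges: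
  assumes \<gamma>: "0 < \<gamma>" "\<gamma> * heat_symbol l < 2"
    and a: "segmenting a"
    and diverges: "filterlim (\<lambda>n. \<Sum>k=1..n. a (k + 1) (k + 1) * (1 - a (k + 1) (k + 1))) at_top sequentially"
    and x: "x \<in> H" "heat x = f" and x1: "x1 \<in> H"
    and F: "\<And>\<phi>. F \<phi> = (\<phi> - \<gamma> *\<^sub>R heat \<phi>) + \<gamma> *\<^sub>R f"
  shows "mann_x x1 a F \<longlonglongrightarrow> x" "mann_v x1 a F \<longlonglongrightarrow> x"
proof -
  define v where "v = mann_v x1 a F"
  \<comment> \<open>Mann indices start at 1 and those of \<open>e\<close> and \<open>d\<close> at 0:
    \<open>e k\<close> is the error of average \<open>k + 1\<close>, whose successor uses the
    diagonal entry of row \<open>k + 2\<close>.\<close>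
  define d where "d k = a (k + 2) (k + 2)" for k
  define e where "e k = v (Suc k) - x" for k
  have d: "0 \<le> d k" "d k \<le> 1" for k
    using segmenting_diagonal_bounds[OF a, of "k + 2"] by (auto simp: d_def)
  have F_err: "F \<phi> - x = (\<phi> - x) - \<gamma> *\<^sub>R heat (\<phi> - x)" if "\<phi> \<in> H" for \<phi>
    using that x by (simp add: F heat_diff algebra_simps)
  have FH: "F \<phi> \<in> H" if "\<phi> \<in> H" for \<phi>
    using that x by (auto simp: F)
  have v_Suc: "v (Suc (Suc k)) = (1 - d k) *\<^sub>R v (Suc k) + d k *\<^sub>R F (v (Suc k))" for k
    using mann_v_Suc[OF a, of "Suc k" x1 F] by (simp add: v_def d_def)
  have vH: "v (Suc k) \<in> H" for k
    using mann_v_1[OF a, of x1 F] x1 FH by (induction k) (auto simp: v_Suc v_def[symmetric])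
  have "e (Suc k) = e k - (\<gamma> * d k) *\<^sub>R heat (e k)" for k
  proof -
    have "e (Suc k) = e k + d k *\<^sub>R ((F (v (Suc k)) - x) - e k)"
      by (simp add: e_def v_Suc algebra_simps)
    then show ?thesis
      unfolding F_err[OF vH] e_def[symmetric] by (simp add: mult.commute)
  qed
  then have e: "relaxed_heat_iteration \<gamma> d e"
    using vH x(1) by (simp add: relaxed_heat_iteration_def e_def)
  have "(\<Sum>k=1..n. a (k + 1) (k + 1) * (1 - a (k + 1) (k + 1))) \<le> (\<Sum>j<n. d j)" for n
  proof -
    have "(\<Sum>k=1..n. a (k + 1) (k + 1) * (1 - a (k + 1) (k + 1))) = (\<Sum>j<n. d j * (1 - d j))"
      by (rule sum.reindex_bij_witness[of _ Suc "\<lambda>k. k - 1"]) (auto simp: d_def)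
    also have "\<dots> \<le> (\<Sum>j<n. d j)"
      using d by (intro sum_mono) (simp add: mult_left_le)
    finally show ?thesis .
  qed
  then have "filterlim (\<lambda>n. \<Sum>j<n. d j) at_top sequentially"
    using diverges by (intro filterlim_at_top_mono[OF diverges]) auto
  then have e0: "e \<longlonglongrightarrow> 0"
    by (rule relaxed_heat_iteration_tendsto_0[OF \<gamma> d e])
  then have "(\<lambda>k. v (Suc k)) \<longlonglongrightarrow> x"
    unfolding e_def by (rule LIM_zero_cancel)
  then show "mann_v x1 a F \<longlonglongrightarrow> x"
    unfolding v_def by (rule LIMSEQ_imp_Suc)
  have "norm (mann_x x1 a F (Suc (Suc k)) - x) \<le> norm (e k)" for k
  proof -
    \<comment> \<open>The next iterate is \<open>F\<close> of the current average, that is, a step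
      with relaxation parameter 1. Contraction thus transfers convergence from the averages to the
      iterates.\<close>
    have "mann_x x1 a F (Suc (Suc k)) - x = e k - (\<gamma> * 1) *\<^sub>R heat (e k)"
      using mann_x_Suc[of "Suc k" x1 a F] F_err[OF vH[of k]] by (simp add: e_def v_def)
    then show ?thesis
      using relaxation_contraction[OF \<gamma> d, of "e k" 1] e by (simp add: relaxed_heat_iteration_def)
  qed
  then have "(\<lambda>k. mann_x x1 a F (Suc (Suc k)) - x) \<longlonglongrightarrow> 0"
    using tendsto_norm[OF e0] by (intro Lim_null_comparison[of "\<lambda>k. mann_x x1 a F (Suc (Suc k)) - x"]) auto
  then have "(\<lambda>k. mann_x x1 a F (Suc (Suc k))) \<longlonglongrightarrow> x"
    by (rule LIM_zero_cancel)
  then show "mann_x x1 a F \<longlonglongrightarrow> x"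
    by (rule LIMSEQ_imp_Suc[OF LIMSEQ_imp_Suc])
qed

end

section \<open>The backward heat problem\<close>

locale heat_problem = spectral_operator H E D L + coercive_spectral_space H E l T
  for H :: "'h::real_inner set" and E D L l T +
  assumes symmetric_L: "symmetric_operator D L" and discrete_L: "discrete_spectrum H D L"
begin

text \<open>The energy integrates over the non-negative axis only, but the gap leaves no mass
  elsewhere, and the extra constant 1 adds only the finite total mass. Eigenvectors thereby become
  admissible test vectors.\<close>

lemma H1_eq_D: "H1 H E = D"
proof (intro equalityI subsetI)
  fix \<phi> assume "\<phi> \<in> H1 H E"
  then have \<phi>: "\<phi> \<in> H" and energy: "H1_energy E \<phi> < \<infinity>"
    by (auto simp: H1_def)
  have "{..0} \<in> null_sets (spectral_measure E \<phi>)"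
    using gap[OF l_pos \<phi>] \<phi> by (simp add: null_sets_def emeasure_spectral_measure_Iic)
  then have "AE s in spectral_measure E \<phi>. s \<notin> {..0}"
    by (rule AE_not_in)
  then have "(\<integral>\<^sup>+s. ennreal (s\<^sup>2) \<partial>spectral_measure E \<phi>) \<le> H1_energy E \<phi>"
    unfolding H1_energy_def by (intro nn_integral_mono_AE) (auto elim!: eventually_mono intro!: ennreal_leI)
  with energy \<phi> show "\<phi> \<in> D"
    by (simp add: D_eq spectral_domain_def)
next
  fix \<phi> assume "\<phi> \<in> D"
  then have \<phi>: "\<phi> \<in> H" and fin: "(\<integral>\<^sup>+s. ennreal (s\<^sup>2) \<partial>spectral_measure E \<phi>) < \<infinity>"
    by (auto simp: D_eq spectral_domain_def)
  have "H1_energy E \<phi> \<le> (\<integral>\<^sup>+s. 1 + ennreal (s\<^sup>2) \<partial>spectral_measure E \<phi>)"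
    unfolding H1_energy_def by (intro nn_integral_mono) (auto simp: indicator_def)
  also have "\<dots> = (\<integral>\<^sup>+s. 1 \<partial>spectral_measure E \<phi>) + (\<integral>\<^sup>+s. ennreal (s\<^sup>2) \<partial>spectral_measure E \<phi>)"
    by (rule nn_integral_add) auto
  also have "\<dots> < \<infinity>"
    using fin by (simp add: emeasure_spectral_measure_UNIV[OF \<phi>])
  finally show "\<phi> \<in> H1 H E"
    using \<phi> by (simp add: H1_def)
qed

text \<open>For nonzero \<open>p\<close> the gap forces \<open>s\<close> to be at least
  \<open>l\<close>, which provides the sign condition of \<open>heat_eigen\<close>.\<close>

lemma heat_eigenjump:
  assumes "eigenjump s p"
  shows "heat p = heat_symbol s *\<^sub>R p"
proof (cases "p = 0")
  case True
  then show ?thesis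
    using heat_scale[of p 0] assms by (simp add: eigenjump_def)
next
  case False
  have "l \<le> s"
    using gap[of s p] False assms by (force simp: eigenjump_def not_le)
  then show ?thesis
    using assms l_pos by (intro heat_eigen) (auto simp: eigenjump_def)
qed

text \<open>Testing the equation with \<open>p\<close> and moving \<open>L\<close> across by
  symmetry gives \<open>- s^2\<close> times the coefficient of \<open>u t\<close> along
  \<open>p\<close>: a scalar decay equation between times 0 and \<open>T\<close>.\<close>

lemma backward_heat_solution_eigenjump:
  assumes sol: "backward_heat_solution H L E T f u" and p: "eigenjump s p"
  shows "inner f p = heat_symbol s * inner (u 0) p"
proof -
  obtain w where V: "in_V H E T u w"
    and eq: "AE t in lebesgue_on {0<..<T}. \<forall>h\<in>H1 H E. w t h + inner (L (u t)) (L h) = 0"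
    and uT: "u T = f"
    using sol by (auto simp: backward_heat_solution_def)
  have cont: "continuous_on {0..T} u" and uH1: "AE t in lebesgue_on {0<..<T}. u t \<in> H1 H E"
    and wd: "weak_time_derivative H E T u w"
    using V by (auto simp: in_V_def)
  have pD: "p \<in> D" and Lp: "L p = s *\<^sub>R p"
    using p eigenjump_in_D eigenjump_eigenvector by auto
  have y: "continuous_on {0..T} (\<lambda>t. inner (u t) p)"
    by (intro continuous_intros cont)
  have "inner (u T) p = exp (- (s\<^sup>2) * T) * inner (u 0) p"
  proof (rule weak_exponential_decay[OF T_pos y])
    fix \<theta> assume \<theta>: "test_function T \<theta>"
    then have "continuously_diff 0 \<theta>"
      unfolding test_function_def smooth_def by blast
    then have \<theta>_cont: "continuous_on {0..T} \<theta>"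
      by (auto intro: continuous_on_subset)
    have wp: "(\<lambda>t. w t p) \<in> borel_measurable (lebesgue_on {0<..<T})"
      and ibp: "(\<integral>t. inner (u t) p * deriv \<theta> t \<partial>lebesgue_on {0<..<T}) =
        - (\<integral>t. w t p * \<theta> t \<partial>lebesgue_on {0<..<T})"
      using wd pD \<theta> unfolding weak_time_derivative_def H1_eq_D by blast+
    have \<theta>_meas: "\<theta> \<in> borel_measurable (lebesgue_on {0<..<T})"
      using integrable_lebesgue_on_open_interval[OF \<theta>_cont] by (rule borel_measurable_integrable)
    have y_meas: "(\<lambda>t. inner (u t) p) \<in> borel_measurable (lebesgue_on {0<..<T})"
      using integrable_lebesgue_on_open_interval[OF y] by (rule borel_measurable_integrable)
    have "(\<integral>t. w t p * \<theta> t \<partial>lebesgue_on {0<..<T}) =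
        (\<integral>t. - (s\<^sup>2) * (inner (u t) p * \<theta> t) \<partial>lebesgue_on {0<..<T})"
    proof (rule integral_cong_AE)
      show "(\<lambda>t. w t p * \<theta> t) \<in> borel_measurable (lebesgue_on {0<..<T})"
        by (intro borel_measurable_times wp \<theta>_meas)
      show "(\<lambda>t. - (s\<^sup>2) * (inner (u t) p * \<theta> t)) \<in> borel_measurable (lebesgue_on {0<..<T})"
        by (intro borel_measurable_times y_meas \<theta>_meas borel_measurable_const)
      show "AE t in lebesgue_on {0<..<T}. w t p * \<theta> t = - (s\<^sup>2) * (inner (u t) p * \<theta> t)"
        using eq uH1
      proof eventually_elim
        case (elim t)
        then have uD: "u t \<in> D" and "w t p = - inner (L (u t)) (L p)"
          using pD unfolding H1_eq_D by (auto simp: add_eq_0_iff2)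
        note this(2)
        also have "inner (L (u t)) (L p) = s * inner (u t) (L p)"
          using symmetric_L uD pD by (simp add: Lp symmetric_operator_def)
        finally show ?case
          by (simp add: Lp power2_eq_square)
      qed
    qed
    then show "(\<integral>t. inner (u t) p * deriv \<theta> t \<partial>lebesgue_on {0<..<T}) =
        s\<^sup>2 * (\<integral>t. inner (u t) p * \<theta> t \<partial>lebesgue_on {0<..<T})"
      unfolding ibp by simp
  qed
  then show ?thesis
    by (simp add: uT heat_symbol_def)
qed

text \<open>The data \<open>f\<close> and \<open>heat (u 0)\<close> have equal inner products with
  every eigenjump, and these are total.\<close>

lemma backward_heat_solution_initial_value:
  assumes sol: "backward_heat_solution H L E T f u"
  shows "u 0 \<in> H" "heat (u 0) = f"
proof -
  have uH: "u t \<in> H" if "t \<in> {0..T}" for t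
    using sol that by (auto simp: backward_heat_solution_def in_V_def)
  show u0: "u 0 \<in> H"
    using uH T_pos by simp
  have fH: "f \<in> H"
    using uH[of T] T_pos sol by (simp add: backward_heat_solution_def)
  have "f - heat (u 0) = 0"
  proof (rule orthogonal_to_eigenjumps[OF discrete_L])
    show "f - heat (u 0) \<in> H"
      using fH u0 by simp
    fix s p assume p: "eigenjump s p"
    then have "inner (heat (u 0)) p = heat_symbol s * inner (u 0) p"
      using heat_sym[OF u0, of p] by (simp add: eigenjump_def heat_eigenjump[OF p])
    then show "inner (f - heat (u 0)) p = 0"
      using backward_heat_solution_eigenjump[OF sol p] by (simp add: inner_diff_left)
  qed
  then show "heat (u 0) = f" by simp
qed

end

text \<open>In a discrete spectrum every point has an eigenvector, so positivity of the form bounds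
  the point itself. This makes \<open>Inf\<close> of the spectrum a genuine lower bound.\<close>

lemma spectrum_nonneg:
  assumes "positive_operator D L" "discrete_spectrum H D L" "s \<in> spectrum H D L"
  shows "0 \<le> s"
proof -
  obtain \<phi> where \<phi>: "\<phi> \<in> D" "\<phi> \<noteq> 0" "L \<phi> = s *\<^sub>R \<phi>"
    using assms unfolding discrete_spectrum_def by blast
  then have "0 \<le> s * inner \<phi> \<phi>"
    using assms(1) by (force simp: positive_operator_def)
  then show ?thesis
    using inner_gt_zero_iff[of \<phi>] \<phi>(2) by (metis mult_neg_pos not_le)
qed

lemma heat_problem_intro:
  assumes H: "subspace H" "complete H"
    and "self_adjoint H D L" "positive_operator D L" "discrete_spectrum H D L"
      "resolution_of_identity H D L E" "0 < Inf (spectrum H D L)" "0 < T"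
  shows "heat_problem H E D L (Inf (spectrum H D L)) T"
proof -
  interpret spectral_operator H E D L
    using assms by unfold_locales (auto simp: self_adjoint_def resolution_of_identity_def)
  have "Inf (spectrum H D L) \<le> s" if "s \<in> spectrum H D L" for s
    using spectrum_nonneg[OF assms(4,5)] that by (intro cInf_lower bdd_belowI)
  then have "E t \<phi> = 0" if "t < Inf (spectrum H D L)" "\<phi> \<in> H" for t \<phi>
    using E_below_spectrum that by blast
  then show ?thesis
    using assms by unfold_locales (auto simp: self_adjoint_def)
qed

text \<open>Since \<open>\<gamma>\<close> is nonzero, fixed points of \<open>F\<close> in
  \<open>H\<close> are the solutions of \<open>heat x = f\<close>. Exact data provide one as the
  initial value of a backward solution, and injectivity of \<open>heat\<close> makes it unique; all
  backward solutions hence share this initial value.\<close>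

theorem theorem1:
  fixes \<Omega> :: "(real ^ 'n) set"
    and H D :: "(real ^ 'n) L2 set"
    and \<Lambda> :: "(real ^ 'n) L2 \<Rightarrow> (real ^ 'n) L2"
    and E :: "real \<Rightarrow> (real ^ 'n) L2 \<Rightarrow> (real ^ 'n) L2"
    and T \<gamma> :: real
    and f :: "(real ^ 'n) L2"
    and F :: "(real ^ 'n) L2 \<Rightarrow> (real ^ 'n) L2"
    and a :: "nat \<Rightarrow> nat \<Rightarrow> real"
    and d :: "nat \<Rightarrow> real"
  assumes "open \<Omega>" and "bounded \<Omega>" and "smooth_boundary \<Omega>"
  defines "H \<equiv> L2_on \<Omega>"
  assumes "self_adjoint H D \<Lambda>" and "positive_operator D \<Lambda>" and "discrete_spectrum H D \<Lambda>"
    and "resolution_of_identity H D \<Lambda> E"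
    and "0 < Inf (spectrum H D \<Lambda>)"
    and "0 < T"
    and "f \<in> H"
    and exact_data: "\<exists>u. backward_heat_solution H \<Lambda> E T f u"
    and "0 < \<gamma>" and "\<gamma> < 2 * exp ((Inf (spectrum H D \<Lambda>))\<^sup>2 * T)"
  defines "F \<equiv> \<lambda>\<phi>. (\<phi> - \<gamma> *\<^sub>R spectral_fun H E (\<lambda>s. exp (- (s\<^sup>2) * T)) \<phi>) + \<gamma> *\<^sub>R f"
  assumes "segmenting a"
  defines "d \<equiv> \<lambda>k. a (k + 1) (k + 1)"
  assumes "filterlim (\<lambda>n. \<Sum>k=1..n. d k * (1 - d k)) at_top sequentially"
  shows "F ` H \<subseteq> H \<and>
    (\<exists>x\<in>H. F x = x \<and> (\<forall>y\<in>H. F y = y \<longrightarrow> y = x) \<and>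
      (\<forall>u. backward_heat_solution H \<Lambda> E T f u \<longrightarrow> u 0 = x) \<and>
      (\<forall>x1\<in>H. mann_x x1 a F \<longlonglongrightarrow> x \<and> mann_v x1 a F \<longlonglongrightarrow> x))"
proof -
  have "subspace H" "complete H"
    unfolding H_def using \<open>open \<Omega>\<close>
    by (auto intro: subspace_L2_on complete_L2_on sets_completionI_sets)
  then interpret heat_problem H E D \<Lambda> "Inf (spectrum H D \<Lambda>)" T
    using assms by (intro heat_problem_intro)
  have F: "F \<phi> = (\<phi> - \<gamma> *\<^sub>R heat \<phi>) + \<gamma> *\<^sub>R f" for \<phi>
    by (simp add: F_def heat_def heat_symbol_def[abs_def])
  obtain u0 where "backward_heat_solution H \<Lambda> E T f u0"
    using exact_data by blast
  then obtain x where x: "x \<in> H" "heat x = f"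
    using backward_heat_solution_initial_value by blast
  have unique: "y = x" if "y \<in> H" "heat y = f" for y
  proof -
    have "heat (y - x) = 0"
      using that x by (simp add: heat_diff)
    then show ?thesis
      using heat_inj[of "y - x"] that(1) x(1) by simp
  qed
  have "\<gamma> * heat_symbol (Inf (spectrum H D \<Lambda>)) < 2"
    using \<open>\<gamma> < 2 * exp ((Inf (spectrum H D \<Lambda>))\<^sup>2 * T)\<close>
    by (simp add: heat_symbol_def exp_minus field_simps)
  note conv = mann_iteration_converges[OF \<open>0 < \<gamma>\<close> this \<open>segmenting a\<close> _ x _ F]
  have diverges: "filterlim (\<lambda>n. \<Sum>k=1..n. a (k + 1) (k + 1) * (1 - a (k + 1) (k + 1))) at_top sequentially"
    using \<open>filterlim (\<lambda>n. \<Sum>k=1..n. d k * (1 - d k)) at_top sequentially\<close> by (simp add: d_def)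
  have "F ` H \<subseteq> H"
    using x by (auto simp: F)
  moreover have "F x = x"
    by (simp add: F x)
  moreover have "y = x" if "y \<in> H" "F y = y" for y
    using unique that \<open>0 < \<gamma>\<close> by (simp add: F algebra_simps)
  moreover have "u 0 = x" if "backward_heat_solution H \<Lambda> E T f u" for u
    using unique backward_heat_solution_initial_value[OF that] by blast
  moreover have "mann_x x1 a F \<longlonglongrightarrow> x \<and> mann_v x1 a F \<longlonglongrightarrow> x" if "x1 \<in> H" for x1
    using conv[OF diverges that] by blast
  ultimately show ?thesis
    using x(1) by blast
qed

end
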